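(* Let $f:\mathbb{R}^n\to\mathbb{R}$ be a $\mathcal{C}^2$ function and let $g:\mathbb{R}^n\to\mathbb{R}\cup\{+\infty\}$ be a proper lower semi-continuous function. Suppose that $g$ is both $r$-prox-regular at $\bar x$ and partly smooth at $\bar x$ relative to $\mathcal{M}$. Let $0<\gamma<\bar\gamma\le 1/r$ and let $\bar y\in\mathbb{R}^n$ be such that $\bar x=\mathrm{prox}_{\bar\gamma g}(\bar y-\bar\gamma\nabla f(\bar y))$. Suppose that (i) $\frac{1}{\gamma}(\bar y-\bar x)-\nabla f(\bar y)\in \mathrm{ri}\,\partial g(\bar x)$; and (ii) either (a) $\gamma$ is sufficiently close to $\bar\gamma$, or (b) $\bar y$ is sufficiently close to $\bar x$. Then the proximal gradient map $y\mapsto \mathrm{prox}_{\gamma g}(y-\gamma\nabla f(y))$ is $\mathcal{C}^1$ and $\mathcal{M}$-valued near $\bar y$, i.e. there is a neighborhood of $\bar y$ in $\mathbb{R}^n$ on which it is single-valued, takes values in $\mathcal{M}$ and is continuously differentiable. Here (ii) is understood as follows. In case (a): for given $f,g,\mathcal{M},r,\bar x,\bar y,\bar\gamma$ there exists $\gamma_0<\bar\gamma$ such that the conclusion holds for every $\gamma\in(\gamma_0,\bar\gamma)$, $\gamma>0$, satisfying (i). In case (b): for given $f,g,\mathcal{M},r,\bar x,\gamma,\bar\gamma$ there exists $\delta>0$ such that the conclusion holds for every $\bar y$ with $\|\bar y-\bar x\|<\delta$ satisfying (i) and $\bar x=\mathrm{prox}_{\bar\gamma g}(\bar y-\bar\gamma\nabla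 f(\bar y))$.
   Context: Proximity operator: for $\gamma>0$, $\mathrm{prox}_{\gamma g}(y)=\operatorname{argmin}_{u\in\mathbb{R}^n}\{g(u)+\frac{1}{2\gamma}\|u-y\|^2\}$ (a set-valued map); $x=\mathrm{prox}_{\gamma g}(y)$ means the set equals $\{x\}$. Standing assumption: $\mathrm{prox}_{\gamma g}(y)$ is non-empty for all $y\in\mathbb{R}^n$, $\gamma>0$. Subdifferentials: at $\bar x$ with $g(\bar x)$ finite, the regular subdifferential is $\widehat\partial g(\bar x)=\{v: g(x)\ge g(\bar x)+\langle v,x-\bar x\rangle+o(\|x-\bar x\|)\}$, and the limiting subdifferential is $\partial g(\bar x)=\{\lim_k v_k: v_k\in\widehat\partial g(x_k),\ x_k\to\bar x,\ g(x_k)\to g(\bar x)\}$. $g$ is (Clarke) regular at $\bar x$ if $\widehat\partial g(\bar x)=\partial g(\bar x)$. $\mathrm{ri}$ is the relative interior of a convex set. Prox-regularity ($r>0$): $g$ is $r$-prox-regular at $\bar x$ for $\bar v\in\partial g(\bar x)$ if $g$ is finite and locally lower semi-continuous at $\bar x$ and there is $\varepsilon>0$ such that $g(x')\ge g(x)+\langle v,x'-x\rangle-\frac r2\|x'-x\|^2$ whenever $v\in\partial g(x)$, $\|x-\bar x\|<\varepsilon$, $\|x'-\bar x\|<\varepsilon$, $\|v-\bar v\|<\varepsilon$, $g(x)<g(\bar x)+\varepsilon$. It is $r$-prox-regular at $\bar x$ if this holds for every $\bar v\in\partial g(\bar x)$. Partial smoothness: $g$ is ($\mathcal{C}^2$-)partly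 smooth at $\bar x$ relative to a set $\mathcal{M}\ni\bar x$ if $\mathcal{M}$ is a $\mathcal{C}^2$ submanifold of $\mathbb{R}^n$ around $\bar x$ and: (smoothness) the restriction of $g$ to $\mathcal{M}$ is $\mathcal{C}^2$ near $\bar x$; (regularity) $g$ is Clarke regular at all $x\in\mathcal{M}$ near $\bar x$, with $\partial g(x)\ne\emptyset$; (sharpness) the affine span of $\partial g(\bar x)$ is a translate of the normal space $N_{\bar x}\mathcal{M}$; (sub-continuity) the set-valued map $\partial g$ restricted to $\mathcal{M}$ is continuous at $\bar x$. *)

theory Defs
  imports "HOL-Analysis.Analysis" "HOL-Library.Landau_Symbols"
begin

text \<open>The derivatives are taken in the full space, so the sets \<open>S\<close> below are meant to be open.\<close>

definition C1_on :: "'a set \<Rightarrow> ('a::real_normed_vector \<Rightarrow> 'b::real_normed_vector) \<Rightarrow> bool" where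
  "C1_on S F \<longleftrightarrow> (\<exists>F' :: 'a \<Rightarrow> 'a \<Rightarrow>\<^sub>L 'b.
     (\<forall>x\<in>S. (F has_derivative blinfun_apply (F' x)) (at x)) \<and> continuous_on S F')"

definition C2_on :: "'a set \<Rightarrow> ('a::real_normed_vector \<Rightarrow> 'b::real_normed_vector) \<Rightarrow> bool" where
  "C2_on S F \<longleftrightarrow> (\<exists>F' :: 'a \<Rightarrow> 'a \<Rightarrow>\<^sub>L 'b.
     (\<forall>x\<in>S. (F has_derivative blinfun_apply (F' x)) (at x)) \<and> C1_on S F')"

definition grad :: "('a::euclidean_space \<Rightarrow> real) \<Rightarrow> 'a \<Rightarrow> 'a" where
  "grad f x = (THE D. GDERIV f x :> D)"

definition proper_fun :: "('a \<Rightarrow> ereal) \<Rightarrow> bool" where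
  "proper_fun g \<longleftrightarrow> (\<forall>x. g x \<noteq> -\<infinity>) \<and> (\<exists>x. g x \<noteq> \<infinity>)"

definition lsc :: "('a::topological_space \<Rightarrow> ereal) \<Rightarrow> bool" where
  "lsc g \<longleftrightarrow> (\<forall>x. g x \<le> Liminf (at x) g)"

text \<open>Local lower semicontinuity at a point of finiteness, in the sense of Rockafellar and Wets
  (Variational Analysis, Definition 1.33).\<close>

definition locally_lsc_at :: "('a::metric_space \<Rightarrow> ereal) \<Rightarrow> 'a \<Rightarrow> bool" where
  "locally_lsc_at g xb \<longleftrightarrow>
     (\<exists>e>0. \<forall>\<alpha>. \<alpha> \<le> g xb + ereal e \<longrightarrow> closed {x \<in> cball xb e. g x \<le> \<alpha>})"

definition prox :: "('a::euclidean_space \<Rightarrow> ereal) \<Rightarrow> real \<Rightarrow> 'a \<Rightarrow> 'a set" where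
  "prox g \<gamma> y = {x. is_arg_min (\<lambda>u. g u + ereal (1 / (2 * \<gamma>) * (norm (u - y))\<^sup>2)) (\<lambda>_. True) x}"

definition prox_grad ::
  "('a::euclidean_space \<Rightarrow> real) \<Rightarrow> ('a \<Rightarrow> ereal) \<Rightarrow> real \<Rightarrow> 'a \<Rightarrow> 'a set" where
  "prox_grad f g \<gamma> y = prox g \<gamma> (y - \<gamma> *\<^sub>R grad f y)"

text \<open>Both subdifferentials are empty at points where \<open>g\<close> is not finite.\<close>

definition regular_subdiff :: "('a::euclidean_space \<Rightarrow> ereal) \<Rightarrow> 'a \<Rightarrow> 'a set" where
  "regular_subdiff g xb = {v. \<bar>g xb\<bar> \<noteq> \<infinity> \<and>
     (\<exists>h \<in> o[at xb](\<lambda>x. norm (x - xb)).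
        \<forall>\<^sub>F x in at xb. g x \<ge> g xb + ereal (v \<bullet> (x - xb) + h x))}"

definition limiting_subdiff :: "('a::euclidean_space \<Rightarrow> ereal) \<Rightarrow> 'a \<Rightarrow> 'a set" where
  "limiting_subdiff g xb = {v. \<bar>g xb\<bar> \<noteq> \<infinity> \<and>
     (\<exists>X V. (\<forall>k. V k \<in> regular_subdiff g (X k)) \<and> X \<longlonglongrightarrow> xb \<and>
            (\<lambda>k. g (X k)) \<longlonglongrightarrow> g xb \<and> V \<longlonglongrightarrow> v)}"

definition clarke_regular_at :: "('a::euclidean_space \<Rightarrow> ereal) \<Rightarrow> 'a \<Rightarrow> bool" where
  "clarke_regular_at g xb \<longleftrightarrow>
     \<bar>g xb\<bar> \<noteq> \<infinity> \<and> regular_subdiff g xb = limiting_subdiff g xb"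

definition prox_regular_at_for ::
  "real \<Rightarrow> ('a::euclidean_space \<Rightarrow> ereal) \<Rightarrow> 'a \<Rightarrow> 'a \<Rightarrow> bool" where
  "prox_regular_at_for r g xb vb \<longleftrightarrow>
     \<bar>g xb\<bar> \<noteq> \<infinity> \<and> locally_lsc_at g xb \<and>
     (\<exists>e>0. \<forall>x x' v. v \<in> limiting_subdiff g x \<and> norm (x - xb) < e \<and> norm (x' - xb) < e \<and>
        norm (v - vb) < e \<and> g x < g xb + ereal e \<longrightarrow>
        g x' \<ge> g x + ereal (v \<bullet> (x' - x) - r / 2 * (norm (x' - x))\<^sup>2))"

definition prox_regular_at :: "real \<Rightarrow> ('a::euclidean_space \<Rightarrow> ereal) \<Rightarrow> 'a \<Rightarrow> bool" where
  "prox_regular_at r g xb \<longleftrightarrow> (\<forall>vb \<in> limiting_subdiff g xb. prox_regular_at_for r g xb vb)"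

text \<open>Near \<open>xb\<close> the set \<open>M\<close> is the zero set of a \<open>C\<^sup>2\<close> map with surjective derivative.  Since the
  codimension \<open>m\<close> cannot be a type, the linear subspace \<open>W\<close> plays the role of the codomain
  \<open>\<real>\<^sup>m\<close>, where \<open>m = dim W\<close> ranges over \<open>0, \<dots>, DIM('a)\<close>.\<close>

definition C2_submanifold_around :: "('a::euclidean_space) set \<Rightarrow> 'a \<Rightarrow> bool" where
  "C2_submanifold_around M xb \<longleftrightarrow> xb \<in> M \<and>
     (\<exists>U (W::'a set) (\<Phi>::'a \<Rightarrow> 'a). open U \<and> xb \<in> U \<and> subspace W \<and>
        C2_on U \<Phi> \<and> \<Phi> ` U \<subseteq> W \<and>
        (\<forall>x\<in>U. range (frechet_derivative \<Phi> (at x)) = W) \<and>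
        M \<inter> U = {x\<in>U. \<Phi> x = 0})"

definition tangent_space :: "('a::euclidean_space) set \<Rightarrow> 'a \<Rightarrow> 'a set" where
  "tangent_space M x = {v. \<exists>c e. e > 0 \<and> C1_on {-e<..<e} c \<and> c ` {-e<..<e} \<subseteq> M \<and>
     c (0::real) = x \<and> (c has_vector_derivative v) (at 0)}"

definition normal_space :: "('a::euclidean_space) set \<Rightarrow> 'a \<Rightarrow> 'a set" where
  "normal_space M x = (tangent_space M x)\<^sup>\<bottom>"

text \<open>A function on a submanifold is \<open>C\<^sup>2\<close> near a point iff it has a \<open>C\<^sup>2\<close> extension to a
  neighbourhood of that point in the ambient space.\<close>

definition C2_restriction_near ::
  "('a::euclidean_space \<Rightarrow> ereal) \<Rightarrow> 'a set \<Rightarrow> 'a \<Rightarrow> bool" where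
  "C2_restriction_near g M xb \<longleftrightarrow>
     (\<exists>U h. open U \<and> xb \<in> U \<and> C2_on U h \<and> (\<forall>x \<in> M \<inter> U. g x = ereal (h x)))"

text \<open>Painleve-Kuratowski continuity relative to \<open>M\<close>: the first conjunct is outer, the second
  inner semicontinuity.\<close>

definition setmap_continuous_at_rel ::
  "('a::euclidean_space \<Rightarrow> ('b::euclidean_space) set) \<Rightarrow> 'a set \<Rightarrow> 'a \<Rightarrow> bool" where
  "setmap_continuous_at_rel S M xb \<longleftrightarrow>
     (\<forall>X V v. (\<forall>k. X k \<in> M) \<and> X \<longlonglongrightarrow> xb \<and> (\<forall>k. V k \<in> S (X k)) \<and> V \<longlonglongrightarrow> v \<longrightarrow> v \<in> S xb) \<and>
     (\<forall>v \<in> S xb. \<forall>X. (\<forall>k. X k \<in> M) \<and> X \<longlonglongrightarrow> xb \<longrightarrow>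
        (\<exists>V. V \<longlonglongrightarrow> v \<and> (\<forall>\<^sub>F k in sequentially. V k \<in> S (X k))))"

definition partly_smooth_at ::
  "('a::euclidean_space \<Rightarrow> ereal) \<Rightarrow> 'a set \<Rightarrow> 'a \<Rightarrow> bool" where
  "partly_smooth_at g M xb \<longleftrightarrow>
     C2_submanifold_around M xb \<and>
     C2_restriction_near g M xb \<and>
     (\<exists>e>0. \<forall>x \<in> M \<inter> ball xb e. clarke_regular_at g x \<and> limiting_subdiff g x \<noteq> {}) \<and>
     (\<exists>a. affine hull (limiting_subdiff g xb) = (+) a ` normal_space M xb) \<and>
     setmap_continuous_at_rel (limiting_subdiff g) M xb"

definition C1_and_valued_near ::
  "('a::euclidean_space \<Rightarrow> ('b::euclidean_space) set) \<Rightarrow> 'b set \<Rightarrow> 'a \<Rightarrow> bool" where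
  "C1_and_valued_near T M yb \<longleftrightarrow>
     (\<exists>U p. open U \<and> yb \<in> U \<and> (\<forall>y\<in>U. T y = {p y} \<and> p y \<in> M) \<and> C1_on U p)"

end

theory Submission
  imports Defs
begin

text \<open>Only the composition with the \<open>C\<^sup>1\<close> map \<open>y \<mapsto> y - \<gamma> \<nabla>f(y)\<close> involves \<open>f\<close>,
  so everything reduces to the proximity operator of \<open>g\<close> at a point \<open>wb\<close>.  Decreasing the step
  from \<open>\<gamma>b\<close> to \<open>\<gamma>\<close> keeps \<open>xb\<close> the unique minimiser: near \<open>xb\<close> by
  prox-regularity, far away because the step decrease helps, and in between by compactness in case (a)
  (in case (b) there is no in-between).  On \<open>M\<close>, the first-order system of
  \<open>g + (1/2\<gamma>) \<parallel>\<cdot> - w\<parallel>\<^sup>2\<close> with Lagrange multipliers has an invertible derivative, since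
  prox-regularity with \<open>r < 1/\<gamma>\<close> makes its Hessian positive definite on the tangent space; the
  inverse function theorem gives a \<open>C\<^sup>1\<close> branch \<open>p w\<close> of critical points in \<open>M\<close>.
  Sharpness, inner semicontinuity of the subdifferential along \<open>M\<close> and the relative interior
  condition show that \<open>(w - p w)/\<gamma>\<close> is a subgradient at \<open>p w\<close>.  Any proximal point of
  \<open>w\<close> has the same property, and prox-regularity makes the solution unique.\<close>

section \<open>Calculus of \<open>C\<^sup>1\<close> maps\<close>

text \<open>The order of choices is the obstacle. Prox-regularity provides a radius only for a fixed
  base subgradient, and this base must be chosen before the quantity called sufficiently close. In
  case (a) it is the subgradient belonging to the step \<open>\<gamma>b\<close>; the one for
  \<open>\<gamma>\<close> differs from it by \<open>1/\<gamma> - 1/\<gamma>b\<close> times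
  \<open>yb - xb\<close>. In case (b) \<open>yb\<close> is not yet known, so the base is
  \<open>- grad f xb\<close>, the limit as \<open>yb\<close> tends to \<open>xb\<close>. If that
  vector is no subgradient, closedness of the subdifferential at \<open>xb\<close> makes (i) fail
  for every \<open>yb\<close> close to \<open>xb\<close>.

  Although \<open>\<gamma>b \<le> 1/r\<close> allows equality, \<open>\<gamma> < \<gamma>b\<close>
  yields the strict gap \<open>r < 1/\<gamma>\<close>, on which definiteness of the Hessian and
  uniqueness both rest.

  Proximal points of nearby \<open>w\<close> must not escape to infinity. Their existence for the
  step \<open>2\<gamma>\<close> excludes this: it bounds \<open>g\<close> below by a quadratic of
  half the curvature, which leaves the objective for \<open>\<gamma>\<close> coercive.\<close>

lemma C1_onI:
  assumes "\<And>x. x \<in> S \<Longrightarrow> (F has_derivative blinfun_apply (F' x)) (at x)" "continuous_on S F'"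
  shows "C1_on S F"
  using assms unfolding C1_on_def by blast

lemma C1_onE:
  assumes "C1_on S F"
  obtains F' where "\<And>x. x \<in> S \<Longrightarrow> (F has_derivative blinfun_apply (F' x)) (at x)" "continuous_on S F'"
  using assms unfolding C1_on_def by blast

lemma C1_on_subset: "C1_on S F \<Longrightarrow> T \<subseteq> S \<Longrightarrow> C1_on T F"
  unfolding C1_on_def by (meson continuous_on_subset subsetD)

lemma C1_on_imp_continuous_on:
  assumes "C1_on S F"
  shows "continuous_on S F"
  using assms has_derivative_at_withinI has_derivative_continuous
  unfolding C1_on_def continuous_on_eq_continuous_within by blast

lemma C1_on_bounded_linear:
  assumes "bounded_linear L"
  shows "C1_on S L"
  by (rule C1_onI[where F' = "\<lambda>_. Blinfun L"])
    (auto simp: bounded_linear_Blinfun_apply assms bounded_linear_imp_has_derivative)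

lemma C1_on_const: "C1_on S (\<lambda>_. c)"
  by (rule C1_onI[where F' = "\<lambda>_. 0"]) (auto simp: zero_blinfun.rep_eq)

lemma C1_on_compose:
  assumes F: "C1_on S F" and G: "C1_on T G" and sub: "\<And>x. x \<in> S \<Longrightarrow> F x \<in> T"
  shows "C1_on S (\<lambda>x. G (F x))"
proof -
  obtain F' where F': "\<And>x. x \<in> S \<Longrightarrow> (F has_derivative blinfun_apply (F' x)) (at x)"
    "continuous_on S F'" using F by (rule C1_onE) blast
  obtain G' where G': "\<And>x. x \<in> T \<Longrightarrow> (G has_derivative blinfun_apply (G' x)) (at x)"
    "continuous_on T G'" using G by (rule C1_onE) blast
  show ?thesis
  proof (rule C1_onI)
    fix x assume x: "x \<in> S"
    show "((\<lambda>x. G (F x)) has_derivative blinfun_apply (G' (F x) o\<^sub>L F' x)) (at x)"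
      using has_derivative_compose[OF F'(1)[OF x] G'(1)[OF sub[OF x]]]
      by (simp add: blinfun_compose.rep_eq o_def)
  next
    show "continuous_on S (\<lambda>x. G' (F x) o\<^sub>L F' x)"
      using sub F'(2) C1_on_imp_continuous_on[OF F] G'(2)
      by (intro continuous_intros continuous_on_compose2[of T G' S F]) auto
  qed
qed

lemma C1_on_add:
  assumes F: "C1_on S F" and G: "C1_on S G"
  shows "C1_on S (\<lambda>x. F x + G x)"
proof -
  obtain F' where F': "\<And>x. x \<in> S \<Longrightarrow> (F has_derivative blinfun_apply (F' x)) (at x)"
    "continuous_on S F'" using F by (rule C1_onE) blast
  obtain G' where G': "\<And>x. x \<in> S \<Longrightarrow> (G has_derivative blinfun_apply (G' x)) (at x)"
    "continuous_on S G'" using G by (rule C1_onE) blast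
  show ?thesis
    by (rule C1_onI[where F' = "\<lambda>x. F' x + G' x"])
      (auto simp: plus_blinfun.rep_eq intro!: has_derivative_add F' G' continuous_intros)
qed

lemma C1_on_sum:
  assumes "\<And>i. i \<in> I \<Longrightarrow> C1_on S (F i)"
  shows "C1_on S (\<lambda>x. \<Sum>i\<in>I. F i x)"
  using assms by (induction I rule: infinite_finite_induct) (auto intro: C1_on_add C1_on_const)

lemma C1_on_linear_compose:
  assumes "bounded_linear L" "C1_on S F"
  shows "C1_on S (\<lambda>x. L (F x))"
  using C1_on_compose[OF assms(2) C1_on_bounded_linear[OF assms(1), of UNIV]] by simp

lemma C1_on_Pair:
  assumes "C1_on S F" "C1_on S G"
  shows "C1_on S (\<lambda>x. (F x, G x))"
proof -
  have "C1_on S (\<lambda>x. (F x, 0) + (0, G x))"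
    using assms
    by (intro C1_on_add C1_on_linear_compose[of "\<lambda>y. (y, 0)"] C1_on_linear_compose[of "\<lambda>y. (0, y)"])
      (auto intro!: bounded_linear_Pair bounded_linear_ident bounded_linear_zero)
  then show ?thesis by simp
qed

lemma C1_on_inner:
  fixes F G :: "'a::real_normed_vector \<Rightarrow> 'b::real_inner"
  assumes F: "C1_on S F" and G: "C1_on S G"
  shows "C1_on S (\<lambda>x. F x \<bullet> G x)"
proof -
  obtain F' where F': "\<And>x. x \<in> S \<Longrightarrow> (F has_derivative blinfun_apply (F' x)) (at x)"
    "continuous_on S F'" using F by (rule C1_onE) blast
  obtain G' where G': "\<And>x. x \<in> S \<Longrightarrow> (G has_derivative blinfun_apply (G' x)) (at x)"
    "continuous_on S G'" using G by (rule C1_onE) blast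
  show ?thesis
  proof (rule C1_onI)
    fix x assume x: "x \<in> S"
    show "((\<lambda>x. F x \<bullet> G x) has_derivative
        blinfun_apply ((blinfun_inner_right (F x) o\<^sub>L G' x) + (blinfun_inner_left (G x) o\<^sub>L F' x))) (at x)"
      using has_derivative_inner[OF F'(1)[OF x] G'(1)[OF x]]
      by (simp add: plus_blinfun.rep_eq o_def)
  next
    show "continuous_on S (\<lambda>x. (blinfun_inner_right (F x) o\<^sub>L G' x) + (blinfun_inner_left (G x) o\<^sub>L F' x))"
      by (intro continuous_intros F' G' bounded_linear.continuous_on[OF bounded_linear_blinfun_inner_right]
          bounded_linear.continuous_on[OF bounded_linear_blinfun_inner_left]
          C1_on_imp_continuous_on F G)
  qed
qed

section \<open>Adjoints of operator-valued maps\<close>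

lemma linear_blinfun_apply: "linear (blinfun_apply A)"
  by (rule bounded_linear.linear[OF blinfun.bounded_linear_right])

text \<open>In coordinates the implicitly defined adjoint becomes a finite sum of inner products, to
  which the rules for sums and inner products apply when the operator varies.\<close>

lemma adjoint_eq_sum:
  fixes A :: "'a::euclidean_space \<Rightarrow> 'b::euclidean_space"
  assumes "linear A"
  shows "adjoint A y = (\<Sum>b\<in>Basis. (A b \<bullet> y) *\<^sub>R b)"
  by (simp add: euclidean_representation flip: adjoint_works[OF assms] inner_commute[of "adjoint A y"])

lemma C1_on_adjoint:
  fixes F :: "'z::real_normed_vector \<Rightarrow> 'a::euclidean_space \<Rightarrow>\<^sub>L 'b::euclidean_space"
  assumes "C1_on S F" "C1_on S L"
  shows "C1_on S (\<lambda>x. adjoint (F x) (L x))"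
proof -
  have "adjoint (F x) (L x) = (\<Sum>b\<in>Basis. (F x b \<bullet> L x) *\<^sub>R b)" for x
    by (simp add: adjoint_eq_sum linear_blinfun_apply)
  moreover have "C1_on S (\<lambda>x. \<Sum>b\<in>Basis. (F x b \<bullet> L x) *\<^sub>R b)"
    by (intro C1_on_sum C1_on_linear_compose[OF bounded_linear_scaleR_left] C1_on_inner assms
        C1_on_linear_compose[OF blinfun.bounded_linear_left])
  ultimately show ?thesis by simp
qed

lemma has_derivative_adjoint:
  fixes F :: "'z::real_normed_vector \<Rightarrow> 'a::euclidean_space \<Rightarrow>\<^sub>L 'b::euclidean_space"
  assumes F: "(F has_derivative F') (at x)" and L: "(L has_derivative L') (at x)"
  shows "((\<lambda>x. adjoint (F x) (L x)) has_derivative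
           (\<lambda>h. adjoint (F' h) (L x) + adjoint (F x) (L' h))) (at x)"
proof -
  have 1: "adjoint (blinfun_apply A) y = (\<Sum>b\<in>Basis. (A b \<bullet> y) *\<^sub>R b)"
    for A :: "'a \<Rightarrow>\<^sub>L 'b" and y
    by (simp add: adjoint_eq_sum linear_blinfun_apply)
  have "((\<lambda>x. F x b) has_derivative (\<lambda>h. F' h b)) (at x)" for b
    using bounded_linear.has_derivative[OF blinfun.bounded_linear_left F] .
  then have "((\<lambda>x. \<Sum>b\<in>Basis. (F x b \<bullet> L x) *\<^sub>R b) has_derivative
      (\<lambda>h. \<Sum>b\<in>Basis. (F x b \<bullet> L' h + F' h b \<bullet> L x) *\<^sub>R b)) (at x)"
    by (intro has_derivative_sum has_derivative_scaleR_left has_derivative_inner L)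
  then show ?thesis
    by (simp add: 1 scaleR_add_left sum.distrib add.commute)
qed

lemma adjoint_inner:
  fixes A :: "'a::euclidean_space \<Rightarrow>\<^sub>L 'b::euclidean_space"
  shows "adjoint A y \<bullet> d = A d \<bullet> y"
  using adjoint_works[of A d y] by (simp add: inner_commute linear_blinfun_apply)

text \<open>Operator inversion is continuous by the resolvent identity: \<open>C y - C x\<close> is
  the composition of \<open>C y\<close>, \<open>B x - B y\<close> and \<open>C x\<close>.\<close>

lemma continuous_on_blinfun_inverse:
  fixes B C :: "'z::topological_space \<Rightarrow> 'a::real_normed_vector \<Rightarrow>\<^sub>L 'a"
  assumes B: "continuous_on S B"
    and CB: "\<And>y. y \<in> S \<Longrightarrow> C y o\<^sub>L B y = id_blinfun"
    and BC: "\<And>y. y \<in> S \<Longrightarrow> B y o\<^sub>L C y = id_blinfun"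
  shows "continuous_on S C"
  unfolding continuous_on_def
proof
  fix x assume x: "x \<in> S"
  define F where "F = at x within S"
  have B0: "((\<lambda>y. norm (B x - B y)) \<longlongrightarrow> 0) F"
  proof -
    have "(B \<longlongrightarrow> B x) F"
      unfolding F_def using B x continuous_on_def by blast
    from tendsto_norm[OF tendsto_diff[OF tendsto_const[of "B x"] this]] show ?thesis by simp
  qed
  have id: "C y - C x = C y o\<^sub>L ((B x - B y) o\<^sub>L C x)" if "y \<in> S" for y
  proof (rule blinfun_eqI)
    fix h
    have 1: "B x (C x h) = h"
      using BC[OF x] by (metis blinfun_apply_blinfun_compose blinfun_apply_id_blinfun)
    have 2: "C y (B y (C x h)) = C x h"
      using CB[OF that] by (metis blinfun_apply_blinfun_compose blinfun_apply_id_blinfun)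
    show "(C y - C x) h = (C y o\<^sub>L ((B x - B y) o\<^sub>L C x)) h"
      by (simp add: blinfun.bilinear_simps 1 2)
  qed
  have le: "norm (C y - C x) \<le> norm (C y) * (norm (B x - B y) * norm (C x))" if "y \<in> S" for y
    unfolding id[OF that]
    by (meson norm_blinfun_compose order_trans mult_left_mono norm_ge_zero)
  \<comment> \<open>With the factor 1/2, \<open>norm (C y - C x)\<close> is at most half of
    \<open>norm (C y)\<close>. Hence \<open>norm (C y)\<close> is at most
    \<open>2 * norm (C x)\<close>, and the right-hand side of the estimate no longer involves
    \<open>C y\<close>.\<close>
  have ev: "\<forall>\<^sub>F y in F. norm (B x - B y) * norm (C x) < 1/2"
    by (rule order_tendstoD(2)[OF tendsto_mult_left_zero[OF B0]]) simp
  have evS: "\<forall>\<^sub>F y in F. y \<in> S"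
    unfolding F_def by (simp add: eventually_at_filter)
  have bnd: "\<forall>\<^sub>F y in F. norm (C y - C x) \<le> norm (B x - B y) * (2 * norm (C x) * norm (C x))"
    using ev evS
  proof eventually_elim
    case (elim y)
    have "norm (C y) \<le> norm (C x) + norm (C y - C x)"
      by (metis add.commute norm_triangle_sub)
    also have "norm (C y - C x) \<le> norm (C y) * (1/2)"
      using le[OF elim(2)] mult_left_mono[OF less_imp_le[OF elim(1)], of "norm (C y)"] by simp
    finally have "norm (C y) \<le> 2 * norm (C x)" by simp
    then show ?case
      using order_trans[OF le[OF elim(2)] mult_right_mono[of "norm (C y)" "2 * norm (C x)"]]
      by (simp add: mult_ac)
  qed
  have "((\<lambda>y. C y - C x) \<longlongrightarrow> 0) F"
    by (rule Lim_null_comparison[OF bnd tendsto_mult_left_zero[OF B0]])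
  then show "(C \<longlongrightarrow> C x) (at x within S)"
    unfolding F_def by (simp add: LIM_zero_iff)
qed

text \<open>\<open>inverse_function_theorem\<close> describes the derivative of the local inverse
  pointwise; \<open>C1_on\<close> also asks for its continuity in operator norm, which is
  \<open>continuous_on_blinfun_inverse\<close>. An injective derivative is enough because
  \<open>G\<close> maps the space to itself.\<close>

lemma C1_inverse_function:
  fixes G :: "'a::euclidean_space \<Rightarrow> 'a"
  assumes U: "open U" "x0 \<in> U" and G: "C1_on U G" and D: "(G has_derivative D) (at x0)"
    and inj: "\<And>h. D h = 0 \<Longrightarrow> h = 0"
  obtains V K where "open V" "G x0 \<in> V" "C1_on V K" "K (G x0) = x0"
    "\<And>y. y \<in> V \<Longrightarrow> K y \<in> U" "\<And>y. y \<in> V \<Longrightarrow> G (K y) = y"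
proof -
  obtain G' where G': "\<And>x. x \<in> U \<Longrightarrow> (G has_derivative blinfun_apply (G' x)) (at x)"
    and contG': "continuous_on U G'" using G by (rule C1_onE) blast
  have D_eq: "D = blinfun_apply (G' x0)"
    using has_derivative_unique[OF D G'[OF U(2)]] .
  then have "inj (blinfun_apply (G' x0))"
    using inj by (simp add: linear_injective_0 linear_blinfun_apply)
  then obtain I where I: "linear I" "\<And>x. I (G' x0 x) = x"
    using linear_injective_left_inverse[of "G' x0"] by (metis linear_blinfun_apply comp_apply id_apply)
  have "Blinfun I o\<^sub>L G' x0 = id_blinfun"
    by (rule blinfun_eqI) (simp add: bounded_linear_Blinfun_apply linear_conv_bounded_linear[symmetric] I)
  then obtain U' V K K' where *: "open U'" "U' \<subseteq> U" "x0 \<in> U'" "open V" "G x0 \<in> V"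
    "homeomorphism U' V G K" "\<And>y. y \<in> V \<Longrightarrow> (K has_derivative (K' y)) (at y)"
    "\<And>y. y \<in> V \<Longrightarrow> K' y = inv (blinfun_apply (G' (K y)))"
    "\<And>y. y \<in> V \<Longrightarrow> bij (blinfun_apply (G' (K y)))"
    using inverse_function_theorem[OF U(1) G' contG' U(2)] by metis
  have KV: "K y \<in> U'" "G (K y) = y" if "y \<in> V" for y
    using *(6) that unfolding homeomorphism_def by auto
  define C where "C = (\<lambda>y. Blinfun (K' y))"
  have C: "blinfun_apply (C y) = K' y" if "y \<in> V" for y
    unfolding C_def using *(7)[OF that] by (simp add: bounded_linear_Blinfun_apply has_derivative_bounded_linear)
  have "C1_on V K"
  proof (rule C1_onI)
    fix y assume "y \<in> V"
    then show "(K has_derivative blinfun_apply (C y)) (at y)"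
      using C *(7) by simp
  next
    have "continuous_on V (\<lambda>y. G' (K y))"
      by (rule continuous_on_compose2[OF contG']) (use *(2,6) in \<open>auto simp: homeomorphism_def\<close>)
    then show "continuous_on V C"
    proof (rule continuous_on_blinfun_inverse)
      fix y assume y: "y \<in> V"
      show "C y o\<^sub>L G' (K y) = id_blinfun"
        by (rule blinfun_eqI) (use *(8,9)[OF y] in \<open>simp add: C y bij_is_inj\<close>)
      show "G' (K y) o\<^sub>L C y = id_blinfun"
        by (rule blinfun_eqI) (use *(8,9)[OF y] in \<open>simp add: C y bij_is_surj surj_f_inv_f\<close>)
    qed
  qed
  moreover have "K (G x0) = x0"
    using *(3,6) unfolding homeomorphism_def by auto
  ultimately show thesis
    using that[of V K] KV *(2,4,5) by blast
qed

section \<open>Orthogonal complements and ranges of adjoints\<close>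

lemma orthogonal_residual:
  fixes W :: "'b::euclidean_space set"
  assumes W: "subspace W"
  obtains Q where "linear Q" "\<And>x. Q x = 0 \<longleftrightarrow> x \<in> W" "\<And>x y. y \<in> W \<Longrightarrow> Q x \<bullet> y = 0" "\<And>x. x - Q x \<in> W"
proof -
  have "\<exists>q. (x - q \<in> W) \<and> (\<forall>y\<in>W. q \<bullet> y = 0)" for x
  proof -
    obtain y z where "y \<in> span W" "\<And>w. w \<in> span W \<Longrightarrow> orthogonal z w" "x = y + z"
      using orthogonal_subspace_decomp_exists[of W x] by metis
    then show ?thesis
      using W by (intro exI[of _ z]) (auto simp: span_eq_iff[THEN iffD2] orthogonal_def)
  qed
  then obtain Q where Q: "\<And>x. x - Q x \<in> W" "\<And>x y. y \<in> W \<Longrightarrow> Q x \<bullet> y = 0"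
    by metis
  \<comment> \<open>\<open>Q\<close> is the orthogonal projection onto the complement of
    \<open>W\<close>. It was obtained by mere choice, so its linearity has to come from uniqueness
    of the decomposition.\<close>
  have uniq: "Q x = q" if "x - q \<in> W" "\<And>y. y \<in> W \<Longrightarrow> q \<bullet> y = 0" for x q
  proof -
    have "Q x - q \<in> W"
      using subspace_diff[OF W that(1) Q(1)[of x]] by simp
    then have "(Q x - q) \<bullet> (Q x - q) = 0"
      using Q(2) that(2) by (simp add: inner_diff_left)
    then show ?thesis by simp
  qed
  have "linear Q"
  proof (rule linearI)
    fix x y :: 'b and c :: real
    show "Q (x + y) = Q x + Q y"
      using subspace_add[OF W Q(1)[of x] Q(1)[of y]]
      by (intro uniq) (auto simp: algebra_simps Q(2))
    show "Q (c *\<^sub>R x) = c *\<^sub>R Q x"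
      using subspace_scale[OF W Q(1)[of x], of c]
      by (intro uniq) (auto simp: algebra_simps Q(2))
  qed
  moreover have "Q x = 0 \<longleftrightarrow> x \<in> W" for x
    using Q(1)[of x] uniq[of x 0] subspace_0[OF W] by auto
  ultimately show thesis
    using that Q by blast
qed

text \<open>The image of the adjoint is the orthogonal complement of the kernel. A preimage can be
  moved into \<open>range A\<close> by removing its component orthogonal to that range, which the
  adjoint kills. Multipliers found in this way lie in \<open>range A\<close>, where
  \<open>adjoint_inj_on_range\<close> makes them unique.\<close>

lemma range_adjoint:
  fixes A :: "'a::euclidean_space \<Rightarrow>\<^sub>L 'b::euclidean_space"
  assumes "\<And>d. A d = 0 \<Longrightarrow> n \<bullet> d = 0"
  obtains m where "m \<in> range A" "n = adjoint A m"
proof -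
  have lin: "linear (blinfun_apply A)" by (rule linear_blinfun_apply)
  have "n \<in> (blinfun_apply A -` {0})\<^sup>\<bottom>"
    using assms by (auto simp: orthogonal_comp_def orthogonal_def inner_commute)
  then have "n \<in> range (adjoint A)"
    by (simp add: ker_orthogonal_comp_adjoint[OF lin] orthogonal_comp_self linear_subspace_image
        adjoint_linear[OF lin])
  then obtain y where y: "n = adjoint A y" by blast
  obtain Q where Q: "\<And>x y. y \<in> range A \<Longrightarrow> Q x \<bullet> y = 0" "\<And>x. x - Q x \<in> range A"
    using orthogonal_residual[of "range A"] linear_subspace_image[OF lin subspace_UNIV] by metis
  have "adjoint A (Q y) \<bullet> adjoint A (Q y) = 0"
    using Q(1)[of "A (adjoint A (Q y))" y] by (simp add: adjoint_inner inner_commute)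
  then have "n = adjoint A (y - Q y)"
    by (simp add: y linear_diff[OF adjoint_linear[OF lin]])
  then show thesis using that Q(2) by blast
qed

lemma adjoint_inj_on_range:
  fixes A :: "'a::euclidean_space \<Rightarrow>\<^sub>L 'b::euclidean_space"
  assumes "m \<in> range A" "adjoint A m = 0"
  shows "m = 0"
proof -
  obtain d where d: "m = A d" using assms(1) by blast
  have "m \<bullet> m = adjoint A m \<bullet> d" unfolding adjoint_inner d ..
  then show ?thesis using assms(2) by simp
qed

section \<open>Regular subgradients and proximal points\<close>

lemma regular_subdiff_iff:
  "v \<in> regular_subdiff g x \<longleftrightarrow> \<bar>g x\<bar> \<noteq> \<infinity> \<and>
     (\<forall>e>0. \<forall>\<^sub>F u in at x. g u \<ge> g x + ereal (v \<bullet> (u - x) - e * norm (u - x)))"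
proof (cases "g x")
  case (real a)
  show ?thesis
  proof
    assume "v \<in> regular_subdiff g x"
    then obtain h where h: "h \<in> o[at x](\<lambda>u. norm (u - x))"
      and ev: "\<forall>\<^sub>F u in at x. g u \<ge> g x + ereal (v \<bullet> (u - x) + h u)"
      unfolding regular_subdiff_def by blast
    have "\<forall>\<^sub>F u in at x. g u \<ge> g x + ereal (v \<bullet> (u - x) - e * norm (u - x))" if "e > 0" for e
      using landau_o.smallD[OF h that] ev
    proof eventually_elim
      case (elim u)
      then have "v \<bullet> (u - x) - e * norm (u - x) \<le> v \<bullet> (u - x) + h u" by simp
      then have "g x + ereal (v \<bullet> (u - x) - e * norm (u - x)) \<le> g x + ereal (v \<bullet> (u - x) + h u)"
        by (intro add_left_mono) simp
      then show ?case using elim by (meson order_trans)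
    qed
    then show "\<bar>g x\<bar> \<noteq> \<infinity> \<and>
       (\<forall>e>0. \<forall>\<^sub>F u in at x. g u \<ge> g x + ereal (v \<bullet> (u - x) - e * norm (u - x)))"
      using real by simp
  next
    assume "\<bar>g x\<bar> \<noteq> \<infinity> \<and>
       (\<forall>e>0. \<forall>\<^sub>F u in at x. g u \<ge> g x + ereal (v \<bullet> (u - x) - e * norm (u - x)))"
    then have ev: "\<forall>\<^sub>F u in at x. g u \<ge> g x + ereal (v \<bullet> (u - x) - e * norm (u - x))"
      if "e > 0" for e using that by blast
    \<comment> \<open>This is the smallest correction in absolute value for which the affine bound
      holds. The default 0 is harmless: at \<open>\<infinity>\<close> the bound is trivial, and
      \<open>-\<infinity>\<close> is excluded near \<open>x\<close> by \<open>ev\<close>.\<close>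
    define h where "h = (\<lambda>u. if \<bar>g u\<bar> \<noteq> \<infinity> then min 0 (real_of_ereal (g u) - a - v \<bullet> (u - x)) else 0)"
    have "h \<in> o[at x](\<lambda>u. norm (u - x))"
    proof (rule landau_o.smallI)
      fix e :: real assume "e > 0"
      from ev[OF this] show "\<forall>\<^sub>F u in at x. norm (h u) \<le> e * norm (norm (u - x))"
      proof eventually_elim
        case (elim u)
        then show ?case
          using \<open>e > 0\<close> by (cases "g u") (auto simp: h_def real min_def)
      qed
    qed
    moreover have "\<forall>\<^sub>F u in at x. g u \<ge> g x + ereal (v \<bullet> (u - x) + h u)"
      using ev[OF zero_less_one]
    proof eventually_elim
      case (elim u)
      then show ?case
        by (cases "g u") (auto simp: h_def real min_def)
    qed
    ultimately show "v \<in> regular_subdiff g x"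
      unfolding regular_subdiff_def using real by auto
  qed
qed (auto simp: regular_subdiff_def)

lemma regular_subdiff_subset_limiting: "regular_subdiff g x \<subseteq> limiting_subdiff g x"
proof
  fix v assume v: "v \<in> regular_subdiff g x"
  then have "\<bar>g x\<bar> \<noteq> \<infinity>" by (simp add: regular_subdiff_def)
  then show "v \<in> limiting_subdiff g x"
    unfolding limiting_subdiff_def mem_Collect_eq
    by (intro conjI exI[of _ "\<lambda>_. x"] exI[of _ "\<lambda>_. v"]) (auto simp: v)
qed

text \<open>Closedness and convexity are what the closest-point separation in
  \<open>normal_section_meets_sets\<close> asks for. Clarke regularity carries both over to limiting
  subdifferentials at points of the manifold.\<close>

lemma closed_regular_subdiff: "closed (regular_subdiff g x)"
proof (cases "\<bar>g x\<bar> = \<infinity>")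
  case True
  then have "regular_subdiff g x = {}" unfolding regular_subdiff_def by blast
  then show ?thesis by simp
next
  case False
  have "v \<in> regular_subdiff g x" if v: "v \<in> closure (regular_subdiff g x)" for v
    unfolding regular_subdiff_iff
  proof (intro conjI allI impI False)
    fix e :: real assume e: "e > 0"
    then obtain w where w: "w \<in> regular_subdiff g x" "dist w v < e / 2"
      using v unfolding closure_approachable by (metis half_gt_zero)
    then have "\<forall>\<^sub>F u in at x. g u \<ge> g x + ereal (w \<bullet> (u - x) - e / 2 * norm (u - x))"
      using e unfolding regular_subdiff_iff by (meson half_gt_zero)
    then show "\<forall>\<^sub>F u in at x. g u \<ge> g x + ereal (v \<bullet> (u - x) - e * norm (u - x))"
    proof eventually_elim
      case (elim u)
      have "(v - w) \<bullet> (u - x) \<le> norm (v - w) * norm (u - x)"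
        by (rule norm_cauchy_schwarz)
      also have "\<dots> \<le> e / 2 * norm (u - x)"
        using w(2) by (intro mult_right_mono) (auto simp: dist_norm norm_minus_commute)
      finally have "v \<bullet> (u - x) - e * norm (u - x) \<le> w \<bullet> (u - x) - e / 2 * norm (u - x)"
        by (simp add: inner_diff_left)
      then have "g x + ereal (v \<bullet> (u - x) - e * norm (u - x))
          \<le> g x + ereal (w \<bullet> (u - x) - e / 2 * norm (u - x))"
        by (intro add_left_mono) simp
      then show ?case using elim by (meson order_trans)
    qed
  qed
  then show ?thesis
    by (metis closure_subset closure_closed subset_antisym subsetI closed_closure)
qed

lemma convex_regular_subdiff: "convex (regular_subdiff g x)"
proof (rule convexI)
  fix a b and s t :: real
  assume a: "a \<in> regular_subdiff g x" and b: "b \<in> regular_subdiff g x"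
    and st: "s \<ge> 0" "t \<ge> 0" "s + t = 1"
  show "s *\<^sub>R a + t *\<^sub>R b \<in> regular_subdiff g x"
    unfolding regular_subdiff_iff
  proof (intro conjI allI impI)
    show "\<bar>g x\<bar> \<noteq> \<infinity>" using a unfolding regular_subdiff_iff by simp
    fix e :: real assume "e > 0"
    then have "\<forall>\<^sub>F u in at x. g u \<ge> g x + ereal (a \<bullet> (u - x) - e * norm (u - x))"
      "\<forall>\<^sub>F u in at x. g u \<ge> g x + ereal (b \<bullet> (u - x) - e * norm (u - x))"
      using a b unfolding regular_subdiff_iff by blast+
    then show "\<forall>\<^sub>F u in at x. g u \<ge> g x + ereal ((s *\<^sub>R a + t *\<^sub>R b) \<bullet> (u - x) - e * norm (u - x))"
    proof eventually_elim
      case (elim u)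
      have "s * (a \<bullet> (u - x)) + t * (b \<bullet> (u - x)) \<le> max (a \<bullet> (u - x)) (b \<bullet> (u - x))"
        using st by (intro convex_bound_le) auto
      then have "(s *\<^sub>R a + t *\<^sub>R b) \<bullet> (u - x) - e * norm (u - x)
          \<le> max (a \<bullet> (u - x) - e * norm (u - x)) (b \<bullet> (u - x) - e * norm (u - x))"
        by (auto simp: inner_add_left)
      then have "g x + ereal ((s *\<^sub>R a + t *\<^sub>R b) \<bullet> (u - x) - e * norm (u - x))
         \<le> g x + ereal (max (a \<bullet> (u - x) - e * norm (u - x)) (b \<bullet> (u - x) - e * norm (u - x)))"
        by (intro add_left_mono) (simp only: ereal_less_eq)
      also have "\<dots> \<le> g u"
        using elim by (auto simp: max_def)
      finally show ?case .
    qed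
  qed
qed

lemma regular_subdiff_quadratic_minorant:
  assumes fin: "\<bar>g x\<bar> \<noteq> \<infinity>" and q: "\<And>u. g u \<ge> g x + ereal (v \<bullet> (u - x) - c * (norm (u - x))\<^sup>2)"
  shows "v \<in> regular_subdiff g x"
  unfolding regular_subdiff_iff
proof (intro conjI allI impI fin)
  fix e :: real assume e: "e > 0"
  show "\<forall>\<^sub>F u in at x. g u \<ge> g x + ereal (v \<bullet> (u - x) - e * norm (u - x))"
    unfolding eventually_at
  \<comment> \<open>The sign of \<open>c\<close> is arbitrary, hence the absolute value; adding 1
    keeps the radius meaningful for \<open>c = 0\<close>.\<close>
  proof (intro exI[of _ "e / (\<bar>c\<bar> + 1)"] conjI ballI impI)
    show "e / (\<bar>c\<bar> + 1) > 0" using e by simp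
    fix u assume u: "u \<noteq> x \<and> dist u x < e / (\<bar>c\<bar> + 1)"
    have "c * norm (u - x) \<le> (\<bar>c\<bar> + 1) * norm (u - x)"
      by (intro mult_right_mono) auto
    also have "\<dots> \<le> e"
      using u by (simp add: dist_norm field_simps)
    finally have "c * norm (u - x) * norm (u - x) \<le> e * norm (u - x)"
      by (intro mult_right_mono) auto
    then have "v \<bullet> (u - x) - e * norm (u - x) \<le> v \<bullet> (u - x) - c * (norm (u - x))\<^sup>2"
      by (simp add: power2_eq_square mult.assoc)
    then have "g x + ereal (v \<bullet> (u - x) - e * norm (u - x))
        \<le> g x + ereal (v \<bullet> (u - x) - c * (norm (u - x))\<^sup>2)"
      by (intro add_left_mono) simp
    then show "g u \<ge> g x + ereal (v \<bullet> (u - x) - e * norm (u - x))"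
      using q[of u] by (meson order_trans)
  qed
qed

text \<open>Expanding around \<open>z\<close> turns minimality of \<open>z\<close> for the proximal
  objective into a quadratic minorant of \<open>g\<close> that touches at \<open>z\<close> and has
  slope \<open>(y - z)/\<gamma>\<close>.\<close>

lemma half_square_diff:
  fixes y z u :: "'a::real_inner"
  assumes "\<gamma> \<noteq> 0"
  shows "1 / (2 * \<gamma>) * (norm (z - y))\<^sup>2 - 1 / (2 * \<gamma>) * (norm (u - y))\<^sup>2
    = ((1 / \<gamma>) *\<^sub>R (y - z)) \<bullet> (u - z) - 1 / (2 * \<gamma>) * (norm (u - z))\<^sup>2"
  using assms
  by (simp add: power2_norm_eq_inner inner_diff_left inner_diff_right inner_commute field_simps)

lemma prox_finite:
  assumes g: "proper_fun g" and z: "z \<in> prox g \<gamma> y"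
  shows "\<bar>g z\<bar> \<noteq> \<infinity>"
proof -
  obtain u where "g u \<noteq> \<infinity>" using g unfolding proper_fun_def by blast
  moreover have "\<not> g u + ereal (1 / (2 * \<gamma>) * (norm (u - y))\<^sup>2) < g z + ereal (1 / (2 * \<gamma>) * (norm (z - y))\<^sup>2)"
    using z unfolding prox_def is_arg_min_def by blast
  moreover have "g z \<noteq> -\<infinity>" "g u \<noteq> -\<infinity>" using g unfolding proper_fun_def by auto
  ultimately show ?thesis
    by (cases "g z"; cases "g u") auto
qed

lemma prox_minorant:
  assumes g: "proper_fun g" and \<gamma>: "\<gamma> > 0" and z: "z \<in> prox g \<gamma> y"
  shows "g u \<ge> g z + ereal (((1 / \<gamma>) *\<^sub>R (y - z)) \<bullet> (u - z) - 1 / (2 * \<gamma>) * (norm (u - z))\<^sup>2)"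
proof -
  have "\<not> g u + ereal (1 / (2 * \<gamma>) * (norm (u - y))\<^sup>2) < g z + ereal (1 / (2 * \<gamma>) * (norm (z - y))\<^sup>2)"
    using z unfolding prox_def is_arg_min_def by blast
  moreover have "\<bar>g z\<bar> \<noteq> \<infinity>" using prox_finite[OF g z] .
  moreover have "g u \<noteq> -\<infinity>" using g unfolding proper_fun_def by auto
  moreover have "1 / (2 * \<gamma>) * (norm (z - y))\<^sup>2 - 1 / (2 * \<gamma>) * (norm (u - y))\<^sup>2
    = ((1 / \<gamma>) *\<^sub>R (y - z)) \<bullet> (u - z) - 1 / (2 * \<gamma>) * (norm (u - z))\<^sup>2"
    using half_square_diff[of \<gamma>] \<gamma> by simp
  ultimately show ?thesis
    by (cases "g z"; cases "g u") auto
qed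

lemma prox_subgradient:
  assumes "proper_fun g" "\<gamma> > 0" "z \<in> prox g \<gamma> y"
  shows "(1 / \<gamma>) *\<^sub>R (y - z) \<in> regular_subdiff g z"
  using prox_finite[OF assms(1,3)] prox_minorant[OF assms]
  by (rule regular_subdiff_quadratic_minorant)

lemma prox_eq_singleton_iff:
  assumes g: "proper_fun g" and \<gamma>: "\<gamma> > 0"
  shows "prox g \<gamma> y = {z} \<longleftrightarrow> \<bar>g z\<bar> \<noteq> \<infinity> \<and>
    (\<forall>u. u \<noteq> z \<longrightarrow> g u > g z + ereal (((1 / \<gamma>) *\<^sub>R (y - z)) \<bullet> (u - z) - 1 / (2 * \<gamma>) * (norm (u - z))\<^sup>2))"
proof -
  define F where "F = (\<lambda>u. g u + ereal (1 / (2 * \<gamma>) * (norm (u - y))\<^sup>2))"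
  have prox: "prox g \<gamma> y = {x. \<forall>u. F x \<le> F u}"
    unfolding prox_def is_arg_min_def F_def by (auto simp: not_less)
  have F: "F z < F u \<longleftrightarrow>
      g u > g z + ereal (((1 / \<gamma>) *\<^sub>R (y - z)) \<bullet> (u - z) - 1 / (2 * \<gamma>) * (norm (u - z))\<^sup>2)"
    if "\<bar>g z\<bar> \<noteq> \<infinity>" for u
  proof -
    have "g u \<noteq> -\<infinity>" using g unfolding proper_fun_def by auto
    then show ?thesis
      using that half_square_diff[of \<gamma> z y u] \<gamma> unfolding F_def
      by (cases "g z"; cases "g u") auto
  qed
  have "prox g \<gamma> y = {z} \<longleftrightarrow> (\<forall>u. u \<noteq> z \<longrightarrow> F z < F u)"
  proof
    assume "prox g \<gamma> y = {z}"
    then show "\<forall>u. u \<noteq> z \<longrightarrow> F z < F u"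
      unfolding prox set_eq_iff by (simp add: not_le) (metis leD le_less_trans not_le)
  next
    assume "\<forall>u. u \<noteq> z \<longrightarrow> F z < F u"
    then show "prox g \<gamma> y = {z}"
      unfolding prox set_eq_iff mem_Collect_eq singleton_iff
      by (metis leD less_imp_le order_refl)
  qed
  then show ?thesis
    using F prox_finite[OF g, of z \<gamma> y] by auto
qed

section \<open>Lower semicontinuity and stability of proximal points\<close>

lemma lsc_eventually_gt:
  assumes "lsc g" "c < g x"
  shows "\<forall>\<^sub>F u in nhds x. c < g u"
proof -
  have "c < Liminf (at x) g" using assms unfolding lsc_def by (meson less_le_trans)
  then have "\<forall>\<^sub>F u in at x. c < g u" by (rule less_LiminfD)
  then show ?thesis
    using assms(2) by (simp add: eventually_nhds_conv_at)
qed

text \<open>The difference of \<open>g\<close> and \<open>q\<close> is lower semicontinuous and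
  positive, so it stays away from 0 on a compact set. Arguing with a sequence avoids forming the
  difference where \<open>g\<close> is infinite.\<close>

lemma lsc_compact_gap:
  fixes g :: "'a::euclidean_space \<Rightarrow> ereal"
  assumes g: "lsc g" and N: "compact N" and q: "continuous_on N q"
    and gt: "\<And>u. u \<in> N \<Longrightarrow> g u > ereal (q u)"
  obtains c where "c > 0" "\<And>u. u \<in> N \<Longrightarrow> g u \<ge> ereal (q u + c)"
proof (rule ccontr)
  assume "\<not> thesis"
  then have "\<exists>u\<in>N. g u < ereal (q u + 1 / real (Suc n))" for n
    using that[of "1 / real (Suc n)"] by (force simp: not_le)
  then obtain U where U: "\<And>n. U n \<in> N" "\<And>n. g (U n) < ereal (q (U n) + 1 / real (Suc n))"
    by metis
  obtain u s where us: "u \<in> N" "strict_mono s" "(U \<circ> s) \<longlonglongrightarrow> u"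
    using N U(1) unfolding compact_def by blast
  \<comment> \<open>Along the subsequence the upper bounds on \<open>g\<close> tend to
    \<open>q u\<close> and fall below \<open>m\<close>, whereas lower semicontinuity keeps
    \<open>g\<close> above \<open>m\<close>.\<close>
  obtain m where m: "ereal (q u) < ereal m" "ereal m < g u"
    using ereal_dense2[OF gt[OF us(1)]] by (metis ereal_less_eq(3) less_ereal.simps(1))
  have "(\<lambda>n. q ((U \<circ> s) n)) \<longlonglongrightarrow> q u"
    using continuous_on_tendsto_compose[OF q us(3) us(1)] U(1) by simp
  moreover have "(\<lambda>n. 1 / real (Suc (s n))) \<longlonglongrightarrow> 0"
    using LIMSEQ_subseq_LIMSEQ[OF lim_1_over_n[THEN LIMSEQ_Suc] us(2)] by (simp add: o_def)
  ultimately have "(\<lambda>n. q ((U \<circ> s) n) + 1 / real (Suc (s n))) \<longlonglongrightarrow> q u + 0"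
    by (rule tendsto_add)
  then have "\<forall>\<^sub>F n in sequentially. q ((U \<circ> s) n) + 1 / real (Suc (s n)) < m"
    using m(1) by (intro order_tendstoD) auto
  moreover have "\<forall>\<^sub>F n in sequentially. ereal m < g ((U \<circ> s) n)"
    using lsc_eventually_gt[OF g m(2)] us(3) by (rule eventually_compose_filterlim)
  ultimately have "\<forall>\<^sub>F n in sequentially. False"
  proof eventually_elim
    case (elim n)
    then show ?case using U(2)[of "s n"]
      by (metis comp_apply less_ereal.simps(1) less_trans order.asym)
  qed
  then show False by simp
qed

text \<open>Comparing \<open>z\<close> with \<open>xb\<close> bounds \<open>g z\<close> from above
  with curvature \<open>1/\<gamma>\<close>. A proximal point for the step \<open>2\<gamma>\<close>
  bounds it from below with half that curvature, which confines \<open>z\<close> to a ball of radius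
  \<open>R\<close>. Between the radii \<open>e'\<close> and \<open>R\<close>, strict minimality of
  \<open>xb\<close> leaves a gap \<open>c\<close> that a small change of \<open>w\<close> cannot
  bridge.\<close>

lemma prox_stable:
  fixes g :: "'a::euclidean_space \<Rightarrow> ereal"
  assumes g: "proper_fun g" "lsc g" and \<gamma>: "\<gamma> > 0" and single: "prox g \<gamma> wb = {xb}"
    and coercive: "prox g (2 * \<gamma>) wb \<noteq> {}" and e: "e > 0"
  obtains \<delta> where "\<delta> > 0"
    "\<And>w z. norm (w - wb) < \<delta> \<Longrightarrow> z \<in> prox g \<gamma> w \<Longrightarrow> norm (z - xb) < e \<and> g z < g xb + ereal e"
proof -
  define v where "v = (1 / \<gamma>) *\<^sub>R (wb - xb)"
  define q where "q = (\<lambda>u. v \<bullet> (u - xb) - 1 / (2 * \<gamma>) * (norm (u - xb))\<^sup>2)"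
  obtain a where a: "g xb = ereal a"
    using prox_finite[OF g(1), of xb \<gamma> wb] single by auto
  have gt: "g u > ereal (a + q u)" if "u \<noteq> xb" for u
    using that single unfolding prox_eq_singleton_iff[OF g(1) \<gamma>] q_def v_def a by auto
  obtain z0 where z0: "z0 \<in> prox g (2 * \<gamma>) wb" using coercive by blast
  obtain m where m: "g z0 = ereal m" using prox_finite[OF g(1) z0] by auto
  define K where "K = norm (wb - xb)"
  define C where "C = m + 1 / (4 * \<gamma>) * (norm (z0 - wb))\<^sup>2 - 1 / (4 * \<gamma>) * K\<^sup>2"
  have low: "g u \<ge> ereal (C - 1 / (2 * \<gamma>) * K * norm (u - xb) - 1 / (4 * \<gamma>) * (norm (u - xb))\<^sup>2)" for u
  proof -
    have 1: "g u \<ge> ereal (m + (1 / (4 * \<gamma>) * (norm (z0 - wb))\<^sup>2 - 1 / (4 * \<gamma>) * (norm (u - wb))\<^sup>2))"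
      using prox_minorant[OF g(1) _ z0, of u] half_square_diff[of "2 * \<gamma>" z0 wb u] \<gamma> by (simp add: m)
    have "norm (u - wb) \<le> norm (u - xb) + K"
      unfolding K_def using norm_triangle_ineq[of "u - xb" "xb - wb"] by (simp add: norm_minus_commute)
    then have "(norm (u - wb))\<^sup>2 \<le> (norm (u - xb) + K)\<^sup>2"
      by (intro power_mono) auto
    then have "1 / (4 * \<gamma>) * (norm (u - wb))\<^sup>2 \<le> 1 / (4 * \<gamma>) * (norm (u - xb) + K)\<^sup>2"
      using \<gamma> by (intro mult_left_mono) auto
    also have "\<dots> = 1 / (2 * \<gamma>) * K * norm (u - xb) + 1 / (4 * \<gamma>) * (norm (u - xb))\<^sup>2 + 1 / (4 * \<gamma>) * K\<^sup>2"
      using \<gamma> by (simp add: power2_eq_square field_simps)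
    finally show ?thesis
      by (intro order_trans[OF _ 1]) (simp add: C_def)
  qed
  \<comment> \<open>\<open>L\<close> collects the coefficients of \<open>norm (z - xb)\<close> in
    the lower and the upper bound. \<open>R\<close> is such that \<open>R/(4\<gamma>)\<close>
    exceeds \<open>\<bar>a - C\<bar> + L\<close>, so the quadratic term wins beyond
    \<open>R\<close>.\<close>
  define L where "L = 1 / (2 * \<gamma>) * K + 1 / \<gamma> * (K + 1)"
  define R where "R = 4 * \<gamma> * (\<bar>a - C\<bar> + L) + 1"
  have K0: "K \<ge> 0" unfolding K_def by simp
  have L0: "L \<ge> 0" unfolding L_def using K0 \<gamma> by simp
  have R1: "R \<ge> 1" unfolding R_def using L0 \<gamma> by simp
  \<comment> \<open>The second entry limits the growth of the function value: \<open>g z\<close>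
    exceeds \<open>g xb\<close> by at most \<open>(K + 1)/\<gamma>\<close> times the distance of
    \<open>z\<close> from \<open>xb\<close>.\<close>
  define e' where "e' = min e (e * \<gamma> / (K + 2))"
  have e': "e' > 0" "e' \<le> e" "1 / \<gamma> * (K + 1) * e' < e"
  proof -
    show "e' > 0" "e' \<le> e" unfolding e'_def using e \<gamma> K0 by auto
    have "1 / \<gamma> * (K + 1) * e' \<le> 1 / \<gamma> * (K + 1) * (e * \<gamma> / (K + 2))"
      using \<gamma> K0 by (intro mult_left_mono) (auto simp: e'_def)
    also have "\<dots> = e * ((K + 1) / (K + 2))" using \<gamma> by simp
    also have "\<dots> < e * 1" using e K0 by (intro mult_strict_left_mono) auto
    finally show "1 / \<gamma> * (K + 1) * e' < e" by simp
  qed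
  define N where "N = cball xb R - ball xb e'"
  have "compact N" unfolding N_def by (intro compact_diff) auto
  moreover have "continuous_on N (\<lambda>u. a + q u)"
    unfolding q_def by (intro continuous_intros)
  moreover have "g u > ereal (a + q u)" if "u \<in> N" for u
    using that e'(1) gt[of u] unfolding N_def by (cases "u = xb") auto
  ultimately obtain c where c: "c > 0" "\<And>u. u \<in> N \<Longrightarrow> g u \<ge> ereal (a + q u + c)"
    using lsc_compact_gap[OF g(2)] by blast
  \<comment> \<open>The entry 1 gives \<open>norm (w - xb) \<le> K + 1\<close>; the other makes the
    shift from \<open>wb\<close> to \<open>w\<close> tilt the minorant by less than \<open>c\<close>
    within radius \<open>R\<close>.\<close>
  define \<delta> where "\<delta> = min 1 (c * \<gamma> / R)"
  have \<delta>: "\<delta> > 0" "\<delta> \<le> 1" "1 / \<gamma> * (\<delta> * R) \<le> c"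
    unfolding \<delta>_def using c R1 \<gamma> by (auto simp: min_def field_simps)
  show thesis
  proof (rule that[OF \<delta>(1)])
    fix w z assume w: "norm (w - wb) < \<delta>" and z: "z \<in> prox g \<gamma> w"
    define t where "t = norm (z - xb)"
    obtain b where b: "g z = ereal b" using prox_finite[OF g(1) z] by auto
    have wK: "norm (w - xb) \<le> K + 1"
      unfolding K_def using norm_triangle_ineq[of "w - wb" "wb - xb"] w \<delta>(2) by simp
    have "g xb \<ge> g z + ereal (1 / (2 * \<gamma>) * (norm (z - w))\<^sup>2 - 1 / (2 * \<gamma>) * (norm (xb - w))\<^sup>2)"
      using prox_minorant[OF g(1) \<gamma> z, of xb] half_square_diff[of \<gamma> z w xb] \<gamma> by simp
    then have b_le: "b \<le> a + (((1 / \<gamma>) *\<^sub>R (w - xb)) \<bullet> (z - xb) - 1 / (2 * \<gamma>) * t\<^sup>2)"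
      using half_square_diff[of \<gamma> xb w z] \<gamma> by (simp add: a b t_def)
    have "(w - xb) \<bullet> (z - xb) \<le> (K + 1) * t"
      using norm_cauchy_schwarz[of "w - xb" "z - xb"] mult_right_mono[OF wK, of t] by (simp add: t_def)
    then have wz: "((1 / \<gamma>) *\<^sub>R (w - xb)) \<bullet> (z - xb) \<le> 1 / \<gamma> * (K + 1) * t"
      using \<gamma> by (simp add: divide_right_mono)
    have tR: "t \<le> R"
    proof (rule ccontr)
      assume "\<not> t \<le> R"
      then have t: "t > R" "t > 1" using R1 by auto
      have "C - 1 / (2 * \<gamma>) * K * t - 1 / (4 * \<gamma>) * t\<^sup>2 \<le> b"
        using low[of z] by (simp add: b t_def)
      then have "1 / (2 * \<gamma>) * t\<^sup>2 - 1 / (4 * \<gamma>) * t\<^sup>2 \<le> a - C + L * t"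
        using b_le wz unfolding L_def by (simp add: algebra_simps)
      then have "1 / (4 * \<gamma>) * t\<^sup>2 \<le> a - C + L * t"
        using \<gamma> by (simp add: field_simps)
      also have "\<dots> \<le> (\<bar>a - C\<bar> + L) * t"
        using t(2) mult_left_mono[of 1 t "\<bar>a - C\<bar>"] by (simp add: algebra_simps)
      also have "\<dots> < 1 / (4 * \<gamma>) * R * t"
        unfolding R_def using \<gamma> t(2) by (simp add: field_simps)
      also have "\<dots> \<le> 1 / (4 * \<gamma>) * t * t"
        using t \<gamma> by (intro mult_right_mono mult_left_mono) auto
      finally show False by (simp add: power2_eq_square)
    qed
    have te: "t < e'"
    proof (rule ccontr)
      assume te: "\<not> t < e'"
      then have "z \<in> N" using tR unfolding N_def t_def by (auto simp: dist_norm norm_minus_commute)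
      then have "a + q z + c \<le> b" using c(2)[of z] by (simp add: b)
      then have "c \<le> ((1 / \<gamma>) *\<^sub>R (w - wb)) \<bullet> (z - xb)"
        using b_le unfolding q_def v_def t_def by (simp add: inner_diff_left algebra_simps)
      also have "\<dots> \<le> 1 / \<gamma> * (norm (w - wb) * t)"
        using \<gamma> norm_cauchy_schwarz[of "w - wb" "z - xb"] by (simp add: t_def divide_right_mono)
      also have "\<dots> < 1 / \<gamma> * (\<delta> * t)"
        using \<gamma> w te e'(1) by (intro mult_strict_left_mono mult_strict_right_mono) auto
      also have "\<dots> \<le> 1 / \<gamma> * (\<delta> * R)"
        using \<gamma> \<delta>(1) tR by (intro mult_left_mono) auto
      finally show False using \<delta>(3) by simp
    qed
    have "b \<le> a + 1 / \<gamma> * (K + 1) * t"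
      using b_le wz \<gamma> by (smt (verit) divide_nonneg_pos zero_le_power2 mult_nonneg_nonneg)
    also have "\<dots> \<le> a + 1 / \<gamma> * (K + 1) * e'"
      using te \<gamma> K0 by (intro add_left_mono mult_left_mono) auto
    also have "\<dots> < a + e" using e'(3) by simp
    finally show "norm (z - xb) < e \<and> g z < g xb + ereal e"
      using te e'(2) by (simp add: t_def a b)
  qed
qed

text \<open>Decreasing the step from \<open>\<gamma>b\<close> to \<open>\<gamma>\<close> adds the term
  \<open>(1/\<gamma> - 1/\<gamma>b) (p \<bullet> d - \<parallel>d\<parallel>\<^sup>2/2)\<close> to the quadratic minorant, which is negative
  once \<open>\<parallel>d\<parallel> > 2 \<parallel>p\<parallel>\<close>; so only a compact set of displacements \<open>d\<close> is critical.\<close>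

lemma prox_decrease_step:
  fixes g :: "'a::euclidean_space \<Rightarrow> ereal"
  assumes g: "proper_fun g" and \<gamma>: "0 < \<gamma>" "\<gamma> < \<gamma>b" and single: "prox g \<gamma>b wb = {xb}"
    and r: "r < 1 / \<gamma>" and \<epsilon>: "\<epsilon> > 0"
    and p: "(1 / \<gamma>) *\<^sub>R (w - xb) = (1 / \<gamma>b) *\<^sub>R (wb - xb) + (1 / \<gamma> - 1 / \<gamma>b) *\<^sub>R p"
    and local: "\<And>u. norm (u - xb) < \<epsilon> \<Longrightarrow>
      g u \<ge> g xb + ereal (((1 / \<gamma>) *\<^sub>R (w - xb)) \<bullet> (u - xb) - r / 2 * (norm (u - xb))\<^sup>2)"
    and middle: "\<And>u. \<epsilon> \<le> norm (u - xb) \<Longrightarrow> norm (u - xb) \<le> 2 * norm p \<Longrightarrow>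
      g u > g xb + ereal (((1 / \<gamma>) *\<^sub>R (w - xb)) \<bullet> (u - xb) - 1 / (2 * \<gamma>) * (norm (u - xb))\<^sup>2)"
  shows "prox g \<gamma> w = {xb}"
proof -
  have \<gamma>b: "\<gamma>b > 0" using \<gamma> by simp
  have fin: "\<bar>g xb\<bar> \<noteq> \<infinity>" using prox_finite[OF g, of xb \<gamma>b wb] single by simp
  then obtain a where a: "g xb = ereal a" by auto
  define k where "k = 1 / \<gamma> - 1 / \<gamma>b"
  have k: "k > 0" unfolding k_def using \<gamma> by (simp add: frac_less2)
  show ?thesis
    unfolding prox_eq_singleton_iff[OF g \<gamma>(1)]
  proof (intro conjI allI impI fin)
    fix u assume u: "u \<noteq> xb"
    define d where "d = u - xb"
    have d: "norm d > 0" using u by (simp add: d_def)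
    consider "norm d < \<epsilon>" | "\<epsilon> \<le> norm d" "norm d \<le> 2 * norm p" | "norm d > 2 * norm p"
      by linarith
    then show "g u > g xb + ereal (((1 / \<gamma>) *\<^sub>R (w - xb)) \<bullet> (u - xb) - 1 / (2 * \<gamma>) * (norm (u - xb))\<^sup>2)"
    proof cases
      case 1
      have "r / 2 * (norm d)\<^sup>2 < 1 / (2 * \<gamma>) * (norm d)\<^sup>2"
        using d r by (intro mult_strict_right_mono) auto
      then show ?thesis
        using local[of u] 1 unfolding d_def[symmetric] a
        by (cases "g u") auto
    next
      case 2
      then show ?thesis using middle[of u] by (simp add: d_def)
    next
      case 3
      have "p \<bullet> d \<le> norm p * norm d" by (rule norm_cauchy_schwarz)
      also have "\<dots> < norm d / 2 * norm d"
        using 3 d by (intro mult_strict_right_mono) auto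
      finally have "k * (p \<bullet> d) < k * ((norm d)\<^sup>2 / 2)"
        using k by (intro mult_strict_left_mono) (auto simp: power2_eq_square)
      moreover have "k * ((norm d)\<^sup>2 / 2) = 1 / (2 * \<gamma>) * (norm d)\<^sup>2 - 1 / (2 * \<gamma>b) * (norm d)\<^sup>2"
        unfolding k_def by (simp add: field_simps)
      moreover have "g u > g xb + ereal (((1 / \<gamma>b) *\<^sub>R (wb - xb)) \<bullet> d - 1 / (2 * \<gamma>b) * (norm d)\<^sup>2)"
        using single u unfolding prox_eq_singleton_iff[OF g \<gamma>b] d_def by blast
      ultimately show ?thesis
        unfolding p d_def[symmetric] k_def[symmetric] a
        by (cases "g u") (auto simp: inner_add_left)
    qed
  qed
qed

section \<open>Zero sets of submersions\<close>

lemma le_zero_if_le_epsilon_mult: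
  fixes a b :: real
  assumes "b \<ge> 0" "\<And>e. e > 0 \<Longrightarrow> a \<le> e * b"
  shows "a \<le> 0"
proof (rule ccontr)
  assume "\<not> a \<le> 0"
  then have "a \<le> a / (b + 1) * b" using assms by (intro assms(2) divide_pos_pos) auto
  then show False using \<open>\<not> a \<le> 0\<close> assms(1) by (simp add: field_simps)
qed

lemma has_vector_derivative_quotient:
  fixes c :: "real \<Rightarrow> 'a::real_normed_vector"
  assumes "(c has_vector_derivative d) (at 0)"
  shows "((\<lambda>t. (1 / t) *\<^sub>R (c t - c 0)) \<longlongrightarrow> d) (at 0)"
  unfolding tendsto_iff
proof (intro allI impI)
  fix e :: real assume "e > 0"
  then have "\<forall>\<^sub>F t in at 0. norm (c t - c 0 - (t - 0) *\<^sub>R d) \<le> e / 2 * norm (t - 0)"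
    using assms unfolding has_vector_derivative_def has_derivative_within_alt2 by (meson half_gt_zero)
  moreover have "\<forall>\<^sub>F t in at 0. t \<noteq> (0::real)"
    by (simp add: eventually_at_filter)
  ultimately show "\<forall>\<^sub>F t in at 0. dist ((1 / t) *\<^sub>R (c t - c 0)) d < e"
  proof eventually_elim
    case (elim t)
    have "(1 / t) *\<^sub>R (c t - c 0) - d = (1 / t) *\<^sub>R (c t - c 0 - t *\<^sub>R d)"
      using elim by (simp add: scaleR_diff_right)
    then have "dist ((1 / t) *\<^sub>R (c t - c 0)) d = norm (c t - c 0 - t *\<^sub>R d) / \<bar>t\<bar>"
      by (simp add: dist_norm)
    also have "\<dots> \<le> e / 2"
      using elim by (simp add: field_simps)
    finally show ?case using \<open>e > 0\<close> by simp
  qed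
qed

text \<open>Along the curve, \<open>h\<close> minus the linear function of \<open>v\<close> is
  differentiable at 0 and falls below its value there by at most \<open>o(t)\<close>. Dividing by
  positive and by negative \<open>t\<close> bounds its derivative from both sides. Thus all
  subgradients at a point of a manifold on which \<open>g\<close> is smooth agree in tangent
  directions.\<close>

lemma regular_subgradient_along_curve:
  assumes v: "v \<in> regular_subdiff g x"
    and c: "(c has_vector_derivative d) (at 0)" "c 0 = x"
    and h: "(h has_derivative h') (at x)"
    and gx: "g x = ereal (h x)" and gc: "\<forall>\<^sub>F t in at 0. g (c t) = ereal (h (c t))"
  shows "v \<bullet> d = h' d"
proof -
  define D where "D = h' d - v \<bullet> d"
  have lin: "bounded_linear h'" using h by (rule has_derivative_bounded_linear)
  have "((\<lambda>t. h (c t)) has_derivative (\<lambda>t. h' (t *\<^sub>R d))) (at 0)"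
    using has_derivative_compose[OF c(1)[unfolded has_vector_derivative_def]] h c(2) by blast
  moreover have "((\<lambda>t. v \<bullet> c t) has_derivative (\<lambda>t. v \<bullet> (t *\<^sub>R d))) (at 0)"
    using c(1)[unfolded has_vector_derivative_def] by (rule has_derivative_inner_right)
  ultimately have "((\<lambda>t. h (c t) - v \<bullet> c t) has_derivative (\<lambda>t. h' (t *\<^sub>R d) - v \<bullet> (t *\<^sub>R d))) (at 0)"
    by (rule has_derivative_diff)
  moreover have "h' (t *\<^sub>R d) - v \<bullet> (t *\<^sub>R d) = D *\<^sub>R t" for t
    by (simp add: D_def linear_simps(5)[OF lin] algebra_simps)
  ultimately have "((\<lambda>t. h (c t) - v \<bullet> c t) has_vector_derivative D) (at 0)"
    by (simp add: has_vector_derivative_def mult.commute)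
  then have lim: "((\<lambda>t. (1 / t) *\<^sub>R ((h (c t) - v \<bullet> c t) - (h x - v \<bullet> x))) \<longlongrightarrow> D) (at 0)"
    using has_vector_derivative_quotient[of "\<lambda>t. h (c t) - v \<bullet> c t" D] c(2) by simp
  have nlim: "((\<lambda>t. norm ((1 / t) *\<^sub>R (c t - c 0))) \<longlongrightarrow> norm d) (at 0)"
    using tendsto_norm[OF has_vector_derivative_quotient[OF c(1)]] .
  have cont: "(c \<longlongrightarrow> x) (at 0)"
    using has_vector_derivative_continuous[OF c(1)] c(2) by (simp add: continuous_at isCont_def)
  have main: "\<forall>\<^sub>F t in at 0. (h (c t) - v \<bullet> c t) - (h x - v \<bullet> x) \<ge> - e * norm (c t - c 0)"
    if "e > 0" for e
  proof -
    have "\<forall>\<^sub>F u in at x. g u \<ge> g x + ereal (v \<bullet> (u - x) - e * norm (u - x))"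
      using v that unfolding regular_subdiff_iff by blast
    then have "\<forall>\<^sub>F u in nhds x. g u \<ge> g x + ereal (v \<bullet> (u - x) - e * norm (u - x))"
      by (simp add: eventually_nhds_conv_at gx)
    from eventually_compose_filterlim[OF this cont] gc show ?thesis
    proof eventually_elim
      case (elim t)
      then show ?case by (simp add: gx c(2) inner_diff_right)
    qed
  qed
  have "\<bar>D\<bar> \<le> e * norm d" if e: "e > 0" for e
  proof -
    have R: "\<forall>\<^sub>F t in at_right 0. (1 / t) *\<^sub>R ((h (c t) - v \<bullet> c t) - (h x - v \<bullet> x))
        \<ge> - e * norm ((1 / t) *\<^sub>R (c t - c 0))"
      using main[OF e, THEN eventually_at_split[THEN iffD1], THEN conjunct2] eventually_at_right_less[of 0]
    proof eventually_elim
      case (elim t)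
      then have "1 / t * (- e * norm (c t - c 0)) \<le> 1 / t * ((h (c t) - v \<bullet> c t) - (h x - v \<bullet> x))"
        by (intro mult_left_mono) auto
      then show ?case using elim by (simp add: mult_ac)
    qed
    have L: "\<forall>\<^sub>F t in at_left 0. (1 / t) *\<^sub>R ((h (c t) - v \<bullet> c t) - (h x - v \<bullet> x))
        \<le> e * norm ((1 / t) *\<^sub>R (c t - c 0))"
      using main[OF e, THEN eventually_at_split[THEN iffD1], THEN conjunct1]
        eventually_at_left_real[of "-1" "0::real", simplified]
    proof eventually_elim
      case (elim t)
      then have "1 / t * ((h (c t) - v \<bullet> c t) - (h x - v \<bullet> x)) \<le> 1 / t * (- e * norm (c t - c 0))"
        by (intro mult_left_mono_neg) auto
      then show ?case using elim by (simp add: mult_ac)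
    qed
    note at_mono = at_le[OF subset_UNIV]
    have "- e * norm d \<le> D"
      by (rule tendsto_le[OF trivial_limit_at_right_real tendsto_mono[OF at_mono lim]
          tendsto_mult[OF tendsto_const tendsto_mono[OF at_mono nlim]] R])
    moreover have "D \<le> e * norm d"
      by (rule tendsto_le[OF trivial_limit_at_left_real
          tendsto_mult[OF tendsto_const tendsto_mono[OF at_mono nlim]] tendsto_mono[OF at_mono lim] L])
    ultimately show ?thesis by simp
  qed
  then have "\<bar>D\<bar> \<le> 0" by (rule le_zero_if_le_epsilon_mult[rotated]) auto
  then show ?thesis by (simp add: D_def)
qed

text \<open>The curve has only a first derivative, so \<open>L\<close> along the curve cannot be
  expanded to second order in \<open>t\<close>. Since \<open>G x = 0\<close>, the mean value theorem
  on the straight segment from \<open>x\<close> to \<open>c t\<close> gives a second-order estimate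
  in \<open>c t - x\<close> instead, and division by \<open>t\<^sup>2\<close> then needs only the
  difference quotient of \<open>c\<close>.\<close>

lemma second_order_along_curve:
  fixes L :: "'a::euclidean_space \<Rightarrow> real" and G :: "'a \<Rightarrow> 'a"
  assumes U: "open U" "x \<in> U" and G: "\<And>u. u \<in> U \<Longrightarrow> (L has_derivative (\<lambda>d. G u \<bullet> d)) (at u)"
    and G0: "G x = 0" and B: "(G has_derivative B) (at x)"
    and c: "(c has_vector_derivative d) (at 0)" "c 0 = x"
    and le: "\<forall>\<^sub>F t in at 0. L x \<le> L (c t)"
  shows "B d \<bullet> d \<ge> 0"
proof -
  have lin: "bounded_linear B" using B by (rule has_derivative_bounded_linear)
  have quot: "((\<lambda>t. (1 / t) *\<^sub>R (c t - x)) \<longlongrightarrow> d) (at 0)"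
    using has_vector_derivative_quotient[OF c(1)] c(2) by simp
  have cont: "(c \<longlongrightarrow> x) (at 0)"
    using has_vector_derivative_continuous[OF c(1)] c(2) by (simp add: continuous_at isCont_def)
  have "0 \<le> B d \<bullet> d + e * (norm d)\<^sup>2" if e: "e > 0" for e
  proof -
    obtain \<delta>1 where \<delta>1: "\<delta>1 > 0" "\<And>u. norm (u - x) < \<delta>1 \<Longrightarrow> norm (G u - G x - B (u - x)) \<le> e * norm (u - x)"
      using B e unfolding has_derivative_at_alt by blast
    obtain \<delta>2 where \<delta>2: "\<delta>2 > 0" "ball x \<delta>2 \<subseteq> U"
      using U open_contains_ball by blast
    define \<delta> where "\<delta> = min \<delta>1 \<delta>2"
    \<comment> \<open>At the intermediate point, \<open>G\<close> is \<open>s\<close> times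
      \<open>B k\<close> up to an error \<open>e * s * norm k\<close>; the positive factor
      \<open>s\<close> cancels.\<close>
    have step: "0 \<le> B k \<bullet> k + e * (norm k)\<^sup>2" if k: "norm k < \<delta>" "L x \<le> L (x + k)" for k
    proof -
      have sk: "norm (s *\<^sub>R k) < \<delta>" if "0 \<le> s" "s \<le> 1" for s
        using that k(1) mult_left_le_one_le[of "norm k" s] by (simp add: abs_of_nonneg)
      have "((\<lambda>s. L (x + s *\<^sub>R k)) has_real_derivative G (x + s *\<^sub>R k) \<bullet> k) (at s)"
        if "0 \<le> s" "s \<le> 1" for s
      proof -
        have "x + s *\<^sub>R k \<in> U"
          using sk[OF that] \<delta>2(2) unfolding \<delta>_def by (auto simp: dist_norm)
        have "((\<lambda>s. x + s *\<^sub>R k) has_derivative (\<lambda>s. s *\<^sub>R k)) (at s)"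
          using has_derivative_add[OF has_derivative_const has_derivative_scaleR_left[OF has_derivative_ident]]
          by simp
        then have "((\<lambda>s. L (x + s *\<^sub>R k)) has_derivative (\<lambda>t. G (x + s *\<^sub>R k) \<bullet> (t *\<^sub>R k))) (at s)"
          using G[OF \<open>x + s *\<^sub>R k \<in> U\<close>] by (rule has_derivative_compose)
        then show ?thesis
          unfolding has_field_derivative_def
          by (rule has_derivative_eq_rhs) (simp add: fun_eq_iff)
      qed
      then obtain s where s: "0 < s" "s < 1"
        "L (x + 1 *\<^sub>R k) - L (x + 0 *\<^sub>R k) = (1 - 0) * (G (x + s *\<^sub>R k) \<bullet> k)"
        using MVT2[of 0 1 "\<lambda>s. L (x + s *\<^sub>R k)" "\<lambda>s. G (x + s *\<^sub>R k) \<bullet> k"] by auto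
      have "norm (G (x + s *\<^sub>R k) - B (s *\<^sub>R k)) \<le> e * (s * norm k)"
        using \<delta>1(2)[of "x + s *\<^sub>R k"] sk[of s] s(1,2) G0 unfolding \<delta>_def by simp
      then have "norm (G (x + s *\<^sub>R k) - B (s *\<^sub>R k)) * norm k \<le> e * (s * norm k) * norm k"
        by (rule mult_right_mono) simp
      then have "(G (x + s *\<^sub>R k) - B (s *\<^sub>R k)) \<bullet> k \<le> e * (s * norm k) * norm k"
        by (rule order_trans[OF norm_cauchy_schwarz])
      moreover have "0 \<le> G (x + s *\<^sub>R k) \<bullet> k"
        using s(3) k(2) by simp
      ultimately have "0 \<le> s * (B k \<bullet> k + e * (norm k)\<^sup>2)"
        by (simp add: linear_simps(5)[OF lin] inner_diff_left algebra_simps power2_eq_square)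
      then show ?thesis using s(1) by (simp add: zero_le_mult_iff)
    qed
    have "\<delta> > 0" unfolding \<delta>_def using \<delta>1 \<delta>2 by simp
    then have "\<forall>\<^sub>F t in at 0. norm (c t - x) < \<delta>"
      using tendstoD[OF cont] by (simp add: dist_norm)
    moreover have "\<forall>\<^sub>F t in at 0. t \<noteq> (0::real)"
      by (simp add: eventually_at_filter)
    ultimately have ev: "\<forall>\<^sub>F t in at 0. 0 \<le> B ((1 / t) *\<^sub>R (c t - x)) \<bullet> ((1 / t) *\<^sub>R (c t - x))
        + e * (norm ((1 / t) *\<^sub>R (c t - x)))\<^sup>2"
      using le
    proof eventually_elim
      case (elim t)
      define k where "k = c t - x"
      have "0 \<le> (1 / t)\<^sup>2 * (B k \<bullet> k + e * (norm k)\<^sup>2)"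
        using step[of k] elim by (simp add: k_def)
      also have "\<dots> = (1 / t)\<^sup>2 * (B k \<bullet> k) + e * ((1 / t)\<^sup>2 * (norm k)\<^sup>2)"
        by (simp only: distrib_left mult.left_commute)
      also have "(1 / t)\<^sup>2 * (B k \<bullet> k) = B ((1 / t) *\<^sub>R k) \<bullet> ((1 / t) *\<^sub>R k)"
        by (simp add: linear_simps(5)[OF lin] power2_eq_square)
      also have "(1 / t)\<^sup>2 * (norm k)\<^sup>2 = (norm ((1 / t) *\<^sub>R k))\<^sup>2"
        by (simp only: norm_scaleR power_mult_distrib power2_abs)
      finally show ?case by (simp only: k_def)
    qed
    have lim: "((\<lambda>t. B ((1 / t) *\<^sub>R (c t - x)) \<bullet> ((1 / t) *\<^sub>R (c t - x))
        + e * (norm ((1 / t) *\<^sub>R (c t - x)))\<^sup>2) \<longlongrightarrow> B d \<bullet> d + e * (norm d)\<^sup>2) (at 0)"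
      by (intro tendsto_intros quot bounded_linear.tendsto[OF lin])
    show ?thesis
      by (rule tendsto_lowerbound[OF lim ev]) simp
  qed
  then have "- (B d \<bullet> d) \<le> e * (norm d)\<^sup>2" if "e > 0" for e
    using that by force
  then have "- (B d \<bullet> d) \<le> 0" by (rule le_zero_if_le_epsilon_mult[rotated]) auto
  then show ?thesis by simp
qed

text \<open>The derivative is carried as an operator-valued map, so that second-order smoothness of
  \<open>\<Phi>\<close> becomes \<open>C1_on\<close> of \<open>\<Phi>'\<close>, and the derivative
  of \<open>\<Phi>'\<close> supplies the curvature terms.\<close>

locale zero_set_chart =
  fixes U :: "'a::euclidean_space set" and W :: "'b::euclidean_space set"
    and \<Phi> :: "'a \<Rightarrow> 'b" and \<Phi>' :: "'a \<Rightarrow> 'a \<Rightarrow>\<^sub>L 'b" and M :: "'a set"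
  assumes open_U: "open U"
    and C1_\<Phi>': "C1_on U \<Phi>'"
    and deriv_\<Phi>: "\<And>x. x \<in> U \<Longrightarrow> (\<Phi> has_derivative \<Phi>' x) (at x)"
    and range_\<Phi>': "\<And>x. x \<in> U \<Longrightarrow> range (\<Phi>' x) = W"
    and \<Phi>_in_W: "\<And>x. x \<in> U \<Longrightarrow> \<Phi> x \<in> W"
    and in_M_iff: "\<And>x. x \<in> U \<Longrightarrow> x \<in> M \<longleftrightarrow> \<Phi> x = 0"
begin

lemma C1_\<Phi>: "C1_on U \<Phi>"
  using deriv_\<Phi> C1_on_imp_continuous_on[OF C1_\<Phi>'] by (rule C1_onI)

lemma subspace_W:
  assumes "x \<in> U"
  shows "subspace W"
  using linear_subspace_image[OF linear_blinfun_apply[of "\<Phi>' x"] subspace_UNIV] range_\<Phi>'[OF assms] by simp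

text \<open>This is the converse of \<open>tangent_space_subset_kernel\<close>: every kernel
  direction is the velocity of a curve in the zero set. The curve is the image of the line
  \<open>t *\<^sub>R d\<close> under the local inverse of a suitable chart \<open>J\<close>.\<close>

lemma curve_in_zero_set:
  assumes x: "x \<in> U" "x \<in> M" and d: "\<Phi>' x d = 0"
  obtains c where "c 0 = x" "(c has_vector_derivative d) (at 0)" "\<forall>\<^sub>F t in at 0. c t \<in> M \<inter> U"
proof -
  define A where "A = \<Phi>' x"
  have linA: "linear (blinfun_apply A)" by (rule linear_blinfun_apply)
  have linA': "linear (adjoint A)" by (rule adjoint_linear[OF linA])
  have sub: "subspace (range (adjoint A))"
    by (rule linear_subspace_image[OF linA' subspace_UNIV])
  obtain P where P: "linear P" "\<And>z. P z = 0 \<longleftrightarrow> z \<in> range (adjoint A)"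
    "\<And>z y. y \<in> range (adjoint A) \<Longrightarrow> P z \<bullet> y = 0" "\<And>z. z - P z \<in> range (adjoint A)"
    using orthogonal_residual[OF sub] by blast
  have blP: "bounded_linear P" using P(1) by (simp add: linear_conv_bounded_linear)
  have blA': "bounded_linear (adjoint A)" using linA' by (simp add: linear_conv_bounded_linear)
  \<comment> \<open>\<open>P\<close> projects onto the kernel of \<open>A\<close>. Composing
    \<open>\<Phi>\<close> with the adjoint puts the equations into the complementary subspace, so
    \<open>J\<close> maps the space to itself, and its derivative \<open>J'\<close> is injective and
    fixes \<open>d\<close>.\<close>
  define J where "J = (\<lambda>u. adjoint A (\<Phi> u) + P (u - x))"
  define J' where "J' = (\<lambda>k. adjoint A (A k) + P k)"
  have "C1_on U (\<lambda>u. P (u - x))"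
    using C1_on_linear_compose[OF blP C1_on_add[OF C1_on_bounded_linear[OF bounded_linear_ident] C1_on_const[of _ "-x"]]]
    by simp
  then have J: "C1_on U J"
    unfolding J_def by (intro C1_on_add C1_on_linear_compose[OF blA'] C1_\<Phi>)
  have J'x: "(J has_derivative J') (at x)"
  proof -
    have "((\<lambda>u. P (u - x)) has_derivative P) (at x)"
      using bounded_linear.has_derivative[OF blP
          has_derivative_diff[OF has_derivative_ident has_derivative_const[of x]]] by simp
    then show ?thesis
      unfolding J_def J'_def A_def
      by (intro has_derivative_add bounded_linear.has_derivative[OF blA'[unfolded A_def]] deriv_\<Phi> x(1))
  qed
  have inj: "k = 0" if "J' k = 0" for k
  proof -
    have "J' k \<bullet> adjoint A (A k) = adjoint A (A k) \<bullet> adjoint A (A k)"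
      unfolding J'_def inner_add_left by (simp add: P(3))
    then have 1: "adjoint A (A k) = 0" using that by simp
    then have "P k = 0" using that unfolding J'_def by simp
    then obtain m where "k = adjoint A m" using P(2) by blast
    moreover have "A k = 0" using adjoint_inj_on_range[OF _ 1] by simp
    then have "adjoint A m \<bullet> k = 0" by (simp only: adjoint_inner inner_zero_left)
    ultimately have "k \<bullet> k = 0" by simp
    then show ?thesis by simp
  qed
  obtain V K where V: "open V" "J x \<in> V" "C1_on V K" "K (J x) = x"
    "\<And>y. y \<in> V \<Longrightarrow> K y \<in> U" "\<And>y. y \<in> V \<Longrightarrow> J (K y) = y"
    using C1_inverse_function[OF open_U x(1) J J'x inj] by blast
  have Jx: "J x = 0"
    using x in_M_iff unfolding J_def by (simp add: linear_0[OF linA'] linear_0[OF P(1)])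
  obtain K' where K': "(K has_derivative blinfun_apply K') (at 0)"
    using V(2,3) unfolding C1_on_def Jx by blast
  define c where "c = (\<lambda>t::real. K (t *\<^sub>R d))"
  have "((\<lambda>t::real. t *\<^sub>R d) has_derivative (\<lambda>t. t *\<^sub>R d)) (at 0)"
    using has_derivative_scaleR_left[OF has_derivative_ident] .
  then have "(c has_derivative (\<lambda>t. K' (t *\<^sub>R d))) (at 0)"
    unfolding c_def by (rule has_derivative_compose) (simp add: K')
  then have c': "(c has_vector_derivative K' d) (at 0)"
    unfolding has_vector_derivative_def by (simp add: blinfun.scaleR_right)
  have "((\<lambda>y. J (K y)) has_derivative (\<lambda>y. J' (K' y))) (at 0)"
  proof -
    have "(J has_derivative J') (at (K 0))" using J'x V(4) unfolding Jx by simp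
    with K' show ?thesis by (rule has_derivative_compose)
  qed
  then have "((\<lambda>y. y) has_derivative (\<lambda>y. J' (K' y))) (at 0)"
    by (rule has_derivative_transform_within_open[OF _ V(1)]) (use V Jx in auto)
  with has_derivative_ident have "(\<lambda>y. y) = (\<lambda>y. J' (K' y))"
    by (rule has_derivative_unique)
  then have JK: "J' (K' d) = d"
    by (metis (no_types))
  have Ad: "A d = 0" using d by (simp add: A_def)
  have "J' d = d"
  proof -
    obtain m where m: "d - P d = adjoint A m" using P(4) by blast
    have "A (P d) \<bullet> A (P d) = adjoint A (A (P d)) \<bullet> P d" by (simp add: adjoint_inner)
    also have "\<dots> = 0" using P(3)[of "adjoint A (A (P d))" d] by (simp add: inner_commute)
    finally have "A (P d) = 0" by simp
    then have "A (d - P d) = 0" using Ad by (simp add: blinfun.diff_right)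
    then have "adjoint A m \<bullet> (d - P d) = 0" by (simp only: adjoint_inner inner_zero_left)
    then have "(d - P d) \<bullet> (d - P d) = 0" unfolding m[symmetric] .
    then show ?thesis unfolding J'_def using Ad by (simp add: linear_0[OF linA'])
  qed
  moreover have "J' (K' d - d) = J' (K' d) - J' d"
    unfolding J'_def by (simp add: blinfun.diff_right linear_diff[OF linA'] linear_diff[OF P(1)])
  ultimately have "J' (K' d - d) = 0" using JK by simp
  then have "K' d = d" using inj by fastforce
  moreover have "c 0 = x" unfolding c_def using V(4) Jx by simp
  moreover have "\<forall>\<^sub>F t in at 0. c t \<in> M \<inter> U"
  proof -
    have "((\<lambda>t. t *\<^sub>R d) \<longlongrightarrow> 0 *\<^sub>R d) (at (0::real))"
      by (intro tendsto_intros)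
    then have "\<forall>\<^sub>F t in at (0::real). t *\<^sub>R d \<in> V"
      using V(1,2) Jx by (intro topological_tendstoD) auto
    then show ?thesis
    proof eventually_elim
      case (elim t)
      have cU: "c t \<in> U" unfolding c_def by (rule V(5)[OF elim])
      have *: "adjoint A (\<Phi> (c t)) + P (c t - x) = t *\<^sub>R d"
        using V(6)[OF elim] unfolding c_def J_def .
      \<comment> \<open>Pairing with the image of the adjoint removes both kernel parts, the
        \<open>P\<close> term and \<open>t *\<^sub>R d\<close>. What remains forces
        \<open>\<Phi> (c t) = 0\<close>, since the adjoint is injective on \<open>W\<close>.\<close>
      have "adjoint A (\<Phi> (c t)) \<bullet> adjoint A (\<Phi> (c t)) = (t *\<^sub>R d) \<bullet> adjoint A (\<Phi> (c t))"
        unfolding *[symmetric] inner_add_left by (simp add: P(3))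
      also have "\<dots> = adjoint A (\<Phi> (c t)) \<bullet> (t *\<^sub>R d)" by (rule inner_commute)
      also have "\<dots> = 0" unfolding adjoint_inner by (simp add: blinfun.scaleR_right Ad)
      finally have "\<Phi> (c t) = 0"
        using \<Phi>_in_W[OF cU] range_\<Phi>'[OF x(1)] by (intro adjoint_inj_on_range[of _ A]) (auto simp: A_def)
      then show ?case using cU in_M_iff by blast
    qed
  qed
  ultimately show thesis
    using that c' by metis
qed

text \<open>Differentiating \<open>\<Phi> (c t) = 0\<close> gives this inclusion; it makes images of
  the adjoint derivative normal vectors.\<close>

lemma tangent_space_subset_kernel:
  assumes x: "x \<in> U" and d: "d \<in> tangent_space M x"
  shows "\<Phi>' x d = 0"
proof -
  obtain c e where c: "e > 0" "C1_on {-e<..<e} c" "c ` {-e<..<e} \<subseteq> M" "c (0::real) = x"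
    "(c has_vector_derivative d) (at 0)"
    using d unfolding tangent_space_def by blast
  have 1: "((\<lambda>t. \<Phi> (c t)) has_derivative (\<lambda>t. \<Phi>' x (t *\<^sub>R d))) (at 0)"
    using has_derivative_compose[OF c(5)[unfolded has_vector_derivative_def]] deriv_\<Phi>[OF x] c(4) by simp
  have "(c \<longlongrightarrow> x) (at 0)"
    using has_vector_derivative_continuous[OF c(5)] c(4) by (simp add: continuous_at isCont_def)
  then have "\<forall>\<^sub>F t in at 0. c t \<in> U"
    using open_U x by (rule topological_tendstoD)
  moreover have "\<forall>\<^sub>F t in at 0. t \<in> {-e<..<e}"
    using c(1) by (intro eventually_at_topological[THEN iffD2] exI[of _ "{-e<..<e}"]) auto
  ultimately have "\<forall>\<^sub>F t in at 0. \<Phi> (c t) = 0"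
  proof eventually_elim
    case (elim t)
    then show ?case using c(3) in_M_iff by blast
  qed
  moreover have "\<Phi> (c 0) = 0" using c(1,3,4) x in_M_iff[OF x] by (auto simp: image_subset_iff)
  ultimately have "((\<lambda>t. 0) has_derivative (\<lambda>t. \<Phi>' x (t *\<^sub>R d))) (at (0::real))"
    using has_derivative_transform_eventually[OF 1] by simp
  then have "(\<lambda>t. \<Phi>' x (t *\<^sub>R d)) = (\<lambda>t::real. 0)"
    using has_derivative_unique has_derivative_const by blast
  from fun_cong[OF this, of 1] show ?thesis by simp
qed

text \<open>If \<open>v n \<notin> S (X n)\<close> for all \<open>n\<close>, separate \<open>v n\<close> from \<open>S (X n)\<close> by a
  normal vector, written as the image under the adjoint derivative of a unit vector of \<open>W\<close>: these
  unit vectors have a limit point, which yields a nonzero normal at \<open>xb\<close> supporting \<open>S xb\<close>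
  at a relative interior point.\<close>

lemma normal_section_meets_sets:
  fixes S :: "'a \<Rightarrow> 'a set"
  assumes xb: "xb \<in> U"
    and X: "\<And>n. X n \<in> U" "X \<longlonglongrightarrow> xb"
    and S: "\<And>n. closed (S (X n))" "\<And>n. convex (S (X n))" "\<And>n. S (X n) \<noteq> {}"
    and normal: "\<And>n s d. s \<in> S (X n) \<Longrightarrow> \<Phi>' (X n) d = 0 \<Longrightarrow> s \<bullet> d = v n \<bullet> d"
    and v: "v \<longlonglongrightarrow> vb" "vb \<in> rel_interior (S xb)"
    and aff: "affine hull (S xb) = (+) a ` normal_space M xb"
    and inner: "\<And>s. s \<in> S xb \<Longrightarrow> \<exists>V. V \<longlonglongrightarrow> s \<and> (\<forall>\<^sub>F n in sequentially. V n \<in> S (X n))"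
  shows "\<exists>n. v n \<in> S (X n)"
proof (rule ccontr)
  assume notin: "\<not> (\<exists>n. v n \<in> S (X n))"
  have "\<exists>m. m \<in> W \<and> norm m = 1 \<and> (\<forall>s\<in>S (X n). adjoint (\<Phi>' (X n)) m \<bullet> (s - v n) \<le> 0)" for n
  proof -
    \<comment> \<open>The separating vector \<open>v n - q\<close> vanishes on the kernel because
      \<open>v n\<close> and the elements of \<open>S (X n)\<close> agree there; so it comes from a
      multiplier.\<close>
    define q where "q = closest_point (S (X n)) (v n)"
    have q: "q \<in> S (X n)" unfolding q_def using S by (intro closest_point_in_set)
    have "(v n - q) \<bullet> d = 0" if "\<Phi>' (X n) d = 0" for d
      using normal[OF q that] by (simp add: inner_diff_left)
    then obtain m where m: "m \<in> range (\<Phi>' (X n))" "v n - q = adjoint (\<Phi>' (X n)) m"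
      using range_adjoint[of "\<Phi>' (X n)" "v n - q"] by blast
    have lin: "linear (adjoint (\<Phi>' (X n)))" by (rule adjoint_linear[OF linear_blinfun_apply])
    have "v n - q \<noteq> 0" using notin q by auto
    then have m0: "m \<noteq> 0" using m(2) linear_0[OF lin] by auto
    have mW: "m \<in> W" using m(1) range_\<Phi>'[OF X(1)] by simp
    have "adjoint (\<Phi>' (X n)) ((1 / norm m) *\<^sub>R m) \<bullet> (s - v n) \<le> 0" if s: "s \<in> S (X n)" for s
    proof -
      have "(v n - q) \<bullet> (s - q) \<le> 0"
        unfolding q_def using closest_point_dot[OF S(2) S(1) s] .
      moreover have "(v n - q) \<bullet> (v n - q) \<ge> 0" by simp
      moreover have "(v n - q) \<bullet> (s - v n) = (v n - q) \<bullet> (s - q) - (v n - q) \<bullet> (v n - q)"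
        by (simp add: inner_diff_right)
      ultimately have "(v n - q) \<bullet> (s - v n) \<le> 0" by linarith
      then have "1 / norm m * ((v n - q) \<bullet> (s - v n)) \<le> 0"
        by (intro mult_nonneg_nonpos) auto
      then show ?thesis by (simp add: linear_scale[OF lin] m(2)[symmetric])
    qed
    moreover have "(1 / norm m) *\<^sub>R m \<in> W"
      using subspace_scale[OF subspace_W[OF xb] mW] .
    moreover have "norm ((1 / norm m) *\<^sub>R m) = 1" using m0 by simp
    ultimately show ?thesis by blast
  qed
  then obtain m where m: "\<And>n. m n \<in> W" "\<And>n. norm (m n) = 1"
    "\<And>n s. s \<in> S (X n) \<Longrightarrow> adjoint (\<Phi>' (X n)) (m n) \<bullet> (s - v n) \<le> 0"
    by metis
  \<comment> \<open>The normal spaces vary with \<open>n\<close>, but the multipliers all live in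
    the same \<open>W\<close>; normalising them there gives compactness and a nonzero limit.\<close>
  have "compact (sphere 0 1 \<inter> W)"
    using closed_subspace[OF subspace_W[OF xb]] by (intro compact_Int_closed) auto
  moreover have "\<forall>n. m n \<in> sphere 0 1 \<inter> W" using m by simp
  ultimately obtain mb s where mb: "mb \<in> sphere 0 1 \<inter> W" "strict_mono s" "(m \<circ> s) \<longlonglongrightarrow> mb"
    unfolding compact_def by blast
  define nb where "nb = adjoint (\<Phi>' xb) mb"
  have nb0: "nb \<noteq> 0"
    using adjoint_inj_on_range[of mb "\<Phi>' xb"] mb(1) range_\<Phi>'[OF xb] unfolding nb_def by auto
  have nb_normal: "nb \<in> normal_space M xb"
    unfolding normal_space_def orthogonal_comp_def orthogonal_def nb_def
    using tangent_space_subset_kernel[OF xb] by (auto simp: adjoint_inner inner_commute[of _ "adjoint _ _"])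
  have \<Phi>'_lim: "(\<lambda>n. \<Phi>' (X (s n))) \<longlonglongrightarrow> \<Phi>' xb"
    using continuous_on_tendsto_compose[OF C1_on_imp_continuous_on[OF C1_\<Phi>'] LIMSEQ_subseq_LIMSEQ[OF X(2) mb(2)] xb]
      X(1) by (simp add: o_def)
  have supp: "nb \<bullet> (t - vb) \<le> 0" if t: "t \<in> S xb" for t
  proof -
    obtain V where V: "V \<longlonglongrightarrow> t" "\<forall>\<^sub>F n in sequentially. V n \<in> S (X n)" using inner[OF t] by blast
    have lim: "(\<lambda>n. \<Phi>' (X (s n)) (V (s n) - v (s n)) \<bullet> m (s n)) \<longlonglongrightarrow> \<Phi>' xb (t - vb) \<bullet> mb"
      using mb(3) LIMSEQ_subseq_LIMSEQ[OF V(1) mb(2)] LIMSEQ_subseq_LIMSEQ[OF v(1) mb(2)]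
      by (intro tendsto_inner blinfun.tendsto \<Phi>'_lim tendsto_diff) (simp_all add: o_def)
    have "\<forall>\<^sub>F n in sequentially. V (s n) \<in> S (X (s n))"
      using V(2) filterlim_subseq[OF mb(2)] by (rule eventually_compose_filterlim)
    then have "\<forall>\<^sub>F n in sequentially. \<Phi>' (X (s n)) (V (s n) - v (s n)) \<bullet> m (s n) \<le> 0"
    proof eventually_elim
      case (elim n)
      then show ?case using m(3)[OF elim] by (simp only: adjoint_inner)
    qed
    then show ?thesis
      using tendsto_upperbound[OF lim] unfolding nb_def adjoint_inner by simp
  qed
  obtain e where e: "e > 0" "ball vb e \<inter> affine hull (S xb) \<subseteq> S xb" and vbS: "vb \<in> S xb"
    using v(2) unfolding mem_rel_interior_ball by blast
  \<comment> \<open>A step of length \<open>e/2\<close> along the normal \<open>nb\<close> stays in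
    the affine hull by \<open>aff\<close>, hence in \<open>S xb\<close>, but strictly increases the
    inner product with \<open>nb\<close>, against \<open>supp\<close>.\<close>
  define t where "t = vb + (e / (2 * norm nb)) *\<^sub>R nb"
  have "vb \<in> affine hull (S xb)" using vbS by (rule hull_inc)
  then obtain b where b: "b \<in> normal_space M xb" "vb = a + b" unfolding aff by blast
  have "b + (e / (2 * norm nb)) *\<^sub>R nb \<in> normal_space M xb"
    using b(1) nb_normal unfolding normal_space_def
    by (intro subspace_add subspace_scale subspace_orthogonal_comp)
  then have "t \<in> affine hull (S xb)" unfolding aff t_def b(2) by (auto simp: add.assoc)
  moreover have "t \<in> ball vb e" unfolding t_def using e(1) nb0 by (simp add: dist_norm)
  ultimately have "t \<in> S xb" using e(2) by blast
  then have "nb \<bullet> ((e / (2 * norm nb)) *\<^sub>R nb) \<le> 0" using supp unfolding t_def by fastforce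
  moreover have "nb \<bullet> ((e / (2 * norm nb)) *\<^sub>R nb) > 0"
    using e(1) nb0 by simp
  ultimately show False by simp
qed

text \<open>The inverse function theorem applied to the optimality system of minimising
  \<open>h u + \<rho>/2 \<parallel>u - w\<parallel>\<^sup>2\<close> over the zero set.  As \<open>W\<close> is not a type, the multiplier ranges
  over the whole codomain and the summand \<open>Q\<close>, with kernel \<open>W\<close> and image orthogonal to
  \<open>W\<close>, forces it back into \<open>W\<close>.\<close>

lemma stationary_branch:
  fixes h' :: "'a \<Rightarrow> 'a \<Rightarrow>\<^sub>L real"
  assumes xb: "xb \<in> U" "xb \<in> M" and h': "C1_on U h'"
    and h'': "(h' has_derivative h'') (at xb)" and \<Phi>'': "(\<Phi>' has_derivative \<Phi>'') (at xb)"
    and lb: "lb \<in> W" and \<rho>: "\<rho> > 0"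
    and stat: "\<rho> *\<^sub>R (wb - xb) = adjoint (h' xb) 1 + adjoint (\<Phi>' xb) lb"
    and pos: "\<And>d. \<Phi>' xb d = 0 \<Longrightarrow> d \<noteq> 0 \<Longrightarrow>
      (\<rho> *\<^sub>R d + adjoint (h'' d) 1 + adjoint (\<Phi>'' d) lb) \<bullet> d > 0"
  obtains V p where "open V" "wb \<in> V" "C1_on V p" "p wb = xb"
    "\<And>w. w \<in> V \<Longrightarrow> p w \<in> U" "\<And>w. w \<in> V \<Longrightarrow> p w \<in> M"
    "\<And>w d. w \<in> V \<Longrightarrow> \<Phi>' (p w) d = 0 \<Longrightarrow> (\<rho> *\<^sub>R (w - p w)) \<bullet> d = h' (p w) d"
proof -
  obtain Q where Q: "linear Q" "\<And>x. Q x = 0 \<longleftrightarrow> x \<in> W" "\<And>x y. y \<in> W \<Longrightarrow> Q x \<bullet> y = 0"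
    using orthogonal_residual[OF subspace_W[OF xb(1)]] by metis
  have blQ: "bounded_linear Q" using Q(1) by (simp add: linear_conv_bounded_linear)
  \<comment> \<open>Orthogonality splits the second equation of the system in two: the point lies on
    the manifold and the multiplier lies in \<open>W\<close>.\<close>
  have split0: "x = 0 \<and> Q y = 0" if "x + Q y = 0" "x \<in> W" for x y
  proof -
    have "(x + Q y) \<bullet> x = x \<bullet> x" using Q(3)[OF that(2)] by (simp add: inner_add_left)
    then have "x = 0" using that(1) by simp
    then show ?thesis using that(1) by simp
  qed
  \<comment> \<open>Here \<open>adjoint (h' x) 1\<close> is the gradient of \<open>h\<close> at
    \<open>x\<close>. The datum \<open>w\<close> enters only through the right-hand side
    \<open>(\<rho> *\<^sub>R w, 0)\<close>, so inverting \<open>G\<close> replaces an implicit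
    function argument.\<close>
  define G where "G = (\<lambda>z. (\<rho> *\<^sub>R fst z + adjoint (h' (fst z)) 1 + adjoint (\<Phi>' (fst z)) (snd z),
    \<Phi> (fst z) + Q (snd z)))"
  define D where "D = (\<lambda>z. (\<rho> *\<^sub>R fst z + adjoint (h'' (fst z)) 1
      + (adjoint (\<Phi>'' (fst z)) lb + adjoint (\<Phi>' xb) (snd z)),
    \<Phi>' xb (fst z) + Q (snd z)))"
  have fst: "C1_on (U \<times> UNIV) (\<lambda>z. F (fst z))" if "C1_on U F" for F :: "'a \<Rightarrow> 'c::real_normed_vector"
    by (rule C1_on_compose[OF C1_on_bounded_linear[OF bounded_linear_fst] that]) auto
  have snd: "C1_on (U \<times> (UNIV :: 'b set)) snd" by (rule C1_on_bounded_linear[OF bounded_linear_snd])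
  have C1G: "C1_on (U \<times> UNIV) G"
    unfolding G_def
    by (intro C1_on_Pair C1_on_add C1_on_adjoint fst[OF h'] fst[OF C1_\<Phi>'] fst[OF C1_\<Phi>]
        C1_on_const C1_on_linear_compose[OF blQ] snd
        fst[of "\<lambda>x. \<rho> *\<^sub>R x", OF C1_on_bounded_linear[OF bounded_linear_scaleR_right]])
  have fst': "((\<lambda>z. F (fst z)) has_derivative (\<lambda>k. F' (fst k))) (at (xb, lb))"
    if "(F has_derivative F') (at xb)" for F :: "'a \<Rightarrow> 'c::real_normed_vector" and F'
    using has_derivative_compose[OF bounded_linear_imp_has_derivative[OF bounded_linear_fst], of F F' "(xb, lb)" UNIV] that
    by simp
  have snd': "(snd has_derivative snd) (at (xb, lb))"
    by (rule bounded_linear_imp_has_derivative[OF bounded_linear_snd])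
  have D: "(G has_derivative D) (at (xb, lb))"
  proof -
    have 1: "((\<lambda>z. adjoint (h' (fst z)) 1) has_derivative (\<lambda>k. adjoint (h'' (fst k)) 1)) (at (xb, lb))"
      using has_derivative_adjoint[OF fst'[OF h''] has_derivative_const[of "1::real"]]
      by (simp add: linear_0[OF adjoint_linear[OF linear_blinfun_apply]])
    have 2: "((\<lambda>z. adjoint (\<Phi>' (fst z)) (snd z)) has_derivative
        (\<lambda>k. adjoint (\<Phi>'' (fst k)) lb + adjoint (\<Phi>' xb) (snd k))) (at (xb, lb))"
      using has_derivative_adjoint[OF fst'[OF \<Phi>''] snd'] by simp
    have 3: "((\<lambda>z. \<rho> *\<^sub>R fst z) has_derivative (\<lambda>k. \<rho> *\<^sub>R fst k)) (at (xb, lb))"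
      by (rule fst'[OF bounded_linear_imp_has_derivative[OF bounded_linear_scaleR_right]])
    have 4: "((\<lambda>z. Q (snd z)) has_derivative (\<lambda>k. Q (snd k))) (at (xb, lb))"
      by (rule bounded_linear.has_derivative[OF blQ snd'])
    show ?thesis
      unfolding G_def D_def
      by (intro has_derivative_Pair has_derivative_add 1 2 3 4 fst' deriv_\<Phi> xb(1))
  qed
  have inj: "z = 0" if "D z = 0" for z
  proof -
    obtain d m where z: "z = (d, m)" by fastforce
    have e1: "\<rho> *\<^sub>R d + adjoint (h'' d) 1 + adjoint (\<Phi>'' d) lb + adjoint (\<Phi>' xb) m = 0"
      and e2: "\<Phi>' xb d + Q m = 0"
      using that unfolding D_def z by (simp_all add: zero_prod_def add.assoc)
    have "\<Phi>' xb d \<in> W" using range_\<Phi>'[OF xb(1)] by blast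
    with split0[OF e2] have dm: "\<Phi>' xb d = 0" "m \<in> W" using Q(2) by auto
    \<comment> \<open>Pairing with the kernel vector \<open>d\<close> eliminates the unknown
      multiplier and leaves the form that \<open>pos\<close> makes positive.\<close>
    have "(\<rho> *\<^sub>R d + adjoint (h'' d) 1 + adjoint (\<Phi>'' d) lb) \<bullet> d = - (adjoint (\<Phi>' xb) m \<bullet> d)"
      using e1 by (simp add: add_eq_0_iff2 inner_minus_left[symmetric] del: inner_minus_left)
    also have "\<dots> = 0" by (simp add: adjoint_inner dm)
    finally have d0: "d = 0" using pos[OF dm(1)] by fastforce
    have "h'' 0 = 0" "\<Phi>'' 0 = 0"
      using has_derivative_bounded_linear[OF h''] has_derivative_bounded_linear[OF \<Phi>'']
      by (auto simp: bounded_linear.linear linear_0)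
    then have "adjoint (\<Phi>' xb) m = 0"
      using e1 unfolding d0 by (simp add: adjoint_eq_sum[OF linear_blinfun_apply] blinfun.zero_left)
    then have "m = 0" using dm(2) range_\<Phi>'[OF xb(1)] by (intro adjoint_inj_on_range[of m "\<Phi>' xb"]) auto
    then show ?thesis using z d0 by (simp add: zero_prod_def)
  qed
  have "open (U \<times> (UNIV :: 'b set))" by (intro open_Times open_U) simp
  then obtain V0 K where V0: "open V0" "G (xb, lb) \<in> V0" "C1_on V0 K" "K (G (xb, lb)) = (xb, lb)"
    "\<And>y. y \<in> V0 \<Longrightarrow> K y \<in> U \<times> UNIV" "\<And>y. y \<in> V0 \<Longrightarrow> G (K y) = y"
    using C1_inverse_function[OF _ _ C1G D inj] xb(1) by (metis SigmaI UNIV_I)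
  define i where "i = (\<lambda>w::'a. (\<rho> *\<^sub>R w, 0::'b))"
  have i: "bounded_linear i"
    unfolding i_def by (intro bounded_linear_Pair bounded_linear_scaleR_right bounded_linear_zero)
  have "\<Phi> xb = 0" "Q lb = 0" using xb in_M_iff Q(2) lb by auto
  then have Gi: "G (xb, lb) = i wb"
    using stat unfolding G_def i_def by (simp add: scaleR_diff_right algebra_simps)
  define p where "p = (\<lambda>w. fst (K (i w)))"
  have KU: "p w \<in> U" if "i w \<in> V0" for w
    using V0(5)[OF that] unfolding p_def by (auto simp: mem_Times_iff)
  have eqs: "\<rho> *\<^sub>R p w + adjoint (h' (p w)) 1 + adjoint (\<Phi>' (p w)) (snd (K (i w))) = \<rho> *\<^sub>R w"
    "\<Phi> (p w) + Q (snd (K (i w))) = 0" if "i w \<in> V0" for w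
    using V0(6)[OF that] unfolding G_def p_def i_def by simp_all
  show thesis
  proof (rule that)
    show "open (i -` V0)"
      by (rule open_vimage[OF V0(1) linear_continuous_on[OF i]])
    show "wb \<in> i -` V0" "p wb = xb" using V0(2,4) Gi unfolding p_def by auto
    show "C1_on (i -` V0) p"
      unfolding p_def
      by (rule C1_on_linear_compose[OF bounded_linear_fst C1_on_compose[OF C1_on_bounded_linear[OF i] V0(3)]]) simp
  next
    fix w assume "w \<in> i -` V0"
    then have w: "i w \<in> V0" by simp
    show "p w \<in> U" using KU[OF w] .
    show "p w \<in> M" using split0[OF eqs(2)[OF w] \<Phi>_in_W[OF KU[OF w]]] in_M_iff[OF KU[OF w]] by simp
  next
    fix w d assume "w \<in> i -` V0" and d: "\<Phi>' (p w) d = 0"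
    then have "\<rho> *\<^sub>R (w - p w) = adjoint (h' (p w)) 1 + adjoint (\<Phi>' (p w)) (snd (K (i w)))"
      using eqs(1)[of w] by (simp add: scaleR_diff_right algebra_simps)
    then show "(\<rho> *\<^sub>R (w - p w)) \<bullet> d = h' (p w) d"
      by (simp add: inner_add_left adjoint_inner d)
  qed
qed

end

section \<open>The proximal gradient map\<close>

lemma partly_smooth_prox_C1:
  fixes g :: "'a::euclidean_space \<Rightarrow> ereal"
  assumes g: "proper_fun g" "lsc g" and prox_ne: "\<And>y \<gamma>. \<gamma> > 0 \<Longrightarrow> prox g \<gamma> y \<noteq> {}"
    and reg: "prox_regular_at r g xb" and ps: "partly_smooth_at g M xb"
    and \<gamma>: "\<gamma> > 0" "r < 1 / \<gamma>" and single: "prox g \<gamma> wb = {xb}"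
    and ri: "(1 / \<gamma>) *\<^sub>R (wb - xb) \<in> rel_interior (limiting_subdiff g xb)"
  shows "C1_and_valued_near (prox g \<gamma>) M wb"
proof -
  define \<rho> where "\<rho> = 1 / \<gamma>"
  have \<rho>: "\<rho> > 0" "r < \<rho>" using \<gamma> unfolding \<rho>_def by auto
  define S where "S = limiting_subdiff g"
  define vb where "vb = \<rho> *\<^sub>R (wb - xb)"
  have vb_ri: "vb \<in> rel_interior (S xb)" using ri unfolding vb_def \<rho>_def S_def .
  then have vb: "vb \<in> S xb" using rel_interior_subset by blast
  have mf: "C2_submanifold_around M xb" and h_ex: "C2_restriction_near g M xb"
    and clarke: "\<exists>e>0. \<forall>x \<in> M \<inter> ball xb e. clarke_regular_at g x \<and> S x \<noteq> {}"
    and aff_ex: "\<exists>a. affine hull (S xb) = (+) a ` normal_space M xb"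
    and cont: "setmap_continuous_at_rel S M xb"
    using ps unfolding partly_smooth_at_def S_def by simp_all
  have xbM: "xb \<in> M" using mf unfolding C2_submanifold_around_def by simp
  obtain U1 and W :: "'a set" and \<Phi> :: "'a \<Rightarrow> 'a" where "open U1 \<and> xb \<in> U1 \<and> subspace W \<and>
    C2_on U1 \<Phi> \<and> \<Phi> ` U1 \<subseteq> W \<and> (\<forall>x\<in>U1. range (frechet_derivative \<Phi> (at x)) = W) \<and>
    M \<inter> U1 = {x\<in>U1. \<Phi> x = 0}"
    using conjunct2[OF mf[unfolded C2_submanifold_around_def]] by (elim exE)
  then have U1: "open U1" "xb \<in> U1" "C2_on U1 \<Phi>" "\<Phi> ` U1 \<subseteq> W"
    "\<And>x. x \<in> U1 \<Longrightarrow> range (frechet_derivative \<Phi> (at x)) = W" "M \<inter> U1 = {x\<in>U1. \<Phi> x = 0}"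
    by simp_all
  obtain \<Phi>' where \<Phi>': "\<And>x. x \<in> U1 \<Longrightarrow> (\<Phi> has_derivative blinfun_apply (\<Phi>' x)) (at x)" "C1_on U1 \<Phi>'"
    using U1(3) unfolding C2_on_def by blast
  obtain U2 h where U2: "open U2" "xb \<in> U2" "C2_on U2 h" "\<And>x. x \<in> M \<inter> U2 \<Longrightarrow> g x = ereal (h x)"
    using h_ex unfolding C2_restriction_near_def by blast
  obtain h' where h': "\<And>x. x \<in> U2 \<Longrightarrow> (h has_derivative blinfun_apply (h' x)) (at x)" "C1_on U2 h'"
    using U2(3) unfolding C2_on_def by blast
  obtain e0 where e0: "e0 > 0" "\<And>x. x \<in> M \<inter> ball xb e0 \<Longrightarrow> clarke_regular_at g x \<and> S x \<noteq> {}"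
    using clarke by blast
  obtain a where aff: "affine hull (S xb) = (+) a ` normal_space M xb"
    using aff_ex by blast
  have inner: "\<exists>V. V \<longlonglongrightarrow> v \<and> (\<forall>\<^sub>F k in sequentially. V k \<in> S (X k))"
    if "v \<in> S xb" "\<And>k. X k \<in> M" "X \<longlonglongrightarrow> xb" for v X
    using cont that unfolding setmap_continuous_at_rel_def by blast
  define U where "U = U1 \<inter> U2 \<inter> ball xb e0"
  have U: "open U" "xb \<in> U" "U \<subseteq> U1" "U \<subseteq> U2" "U \<subseteq> ball xb e0"
    unfolding U_def using U1(1,2) U2(1,2) e0(1) by auto
  interpret zero_set_chart U W \<Phi> \<Phi>' M
  proof
    show "open U" by (rule U(1))
    show "C1_on U \<Phi>'" using \<Phi>'(2) U(3) by (rule C1_on_subset)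
    fix x assume "x \<in> U"
    then have x: "x \<in> U1" using U(3) by blast
    show "(\<Phi> has_derivative blinfun_apply (\<Phi>' x)) (at x)" by (rule \<Phi>'(1)[OF x])
    then show "range (blinfun_apply (\<Phi>' x)) = W"
      using frechet_derivative_at U1(5)[OF x] by metis
    show "\<Phi> x \<in> W" using U1(4) x by blast
    show "x \<in> M \<longleftrightarrow> \<Phi> x = 0" using U1(6) x by blast
  qed
  have gh: "g x = ereal (h x)" if "x \<in> M" "x \<in> U" for x
    using that U2(4) U(4) by blast
  have h'U: "\<And>x. x \<in> U \<Longrightarrow> (h has_derivative blinfun_apply (h' x)) (at x)" and C1h': "C1_on U h'"
    using h' U(4) C1_on_subset by auto
  have Sreg: "S x = regular_subdiff g x" "S x \<noteq> {}" if "x \<in> M" "x \<in> U" for x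
    using that e0(2)[of x] U(5) unfolding clarke_regular_at_def S_def by auto
  have normal: "s \<bullet> d = h' x d" if x: "x \<in> M" "x \<in> U" and s: "s \<in> S x" and d: "\<Phi>' x d = 0" for x s d
  proof -
    obtain c where c: "c 0 = x" "(c has_vector_derivative d) (at 0)" "\<forall>\<^sub>F t in at 0. c t \<in> M \<inter> U"
      using curve_in_zero_set[OF x(2,1) d] by blast
    have "\<forall>\<^sub>F t in at 0. g (c t) = ereal (h (c t))"
      using c(3) by (rule eventually_mono) (use gh in blast)
    moreover have "s \<in> regular_subdiff g x" using s Sreg(1)[OF x] by simp
    ultimately show ?thesis
      using regular_subgradient_along_curve[of s g x c d h "h' x"] c(1,2) h'U[OF x(2)] gh[OF x] by blast
  qed
  have "prox_regular_at_for r g xb vb"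
    using reg vb unfolding prox_regular_at_def S_def by blast
  then obtain \<epsilon> where "\<epsilon> > 0" "\<forall>x x' v. v \<in> S x \<and> norm (x - xb) < \<epsilon> \<and> norm (x' - xb) < \<epsilon> \<and>
      norm (v - vb) < \<epsilon> \<and> g x < g xb + ereal \<epsilon> \<longrightarrow>
      g x' \<ge> g x + ereal (v \<bullet> (x' - x) - r / 2 * (norm (x' - x))\<^sup>2)"
    unfolding prox_regular_at_for_def S_def by blast
  then have \<epsilon>: "\<epsilon> > 0" "\<And>x x' v. v \<in> S x \<Longrightarrow> norm (x - xb) < \<epsilon> \<Longrightarrow> norm (x' - xb) < \<epsilon> \<Longrightarrow>
      norm (v - vb) < \<epsilon> \<Longrightarrow> g x < g xb + ereal \<epsilon> \<Longrightarrow>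
      g x' \<ge> g x + ereal (v \<bullet> (x' - x) - r / 2 * (norm (x' - x))\<^sup>2)"
    by simp_all
  obtain lb where lb: "lb \<in> W" "vb - adjoint (h' xb) 1 = adjoint (\<Phi>' xb) lb"
  proof -
    have "(vb - adjoint (h' xb) 1) \<bullet> d = 0" if "\<Phi>' xb d = 0" for d
      using normal[OF xbM U(2) vb that] by (simp add: inner_diff_left adjoint_inner)
    then show thesis
      using that range_adjoint[of "\<Phi>' xb" "vb - adjoint (h' xb) 1"] range_\<Phi>'[OF U(2)] by metis
  qed
  obtain h'' where h'': "(h' has_derivative h'') (at xb)"
    using C1h' U(2) unfolding C1_on_def by blast
  obtain \<Phi>'' where \<Phi>'': "(\<Phi>' has_derivative \<Phi>'') (at xb)"
    using C1_\<Phi>' U(2) unfolding C1_on_def by blast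

  have pos: "(\<rho> *\<^sub>R d + adjoint (h'' d) 1 + adjoint (\<Phi>'' d) lb) \<bullet> d > 0"
    if d: "\<Phi>' xb d = 0" "d \<noteq> 0" for d
  proof -
    obtain c where c: "c 0 = xb" "(c has_vector_derivative d) (at 0)" "\<forall>\<^sub>F t in at 0. c t \<in> M \<inter> U"
      using curve_in_zero_set[OF U(2) xbM d(1)] by blast
    \<comment> \<open>A Lagrangian, tilted by \<open>vb\<close> and convexified by the
      prox-regularity constant. Its gradient \<open>G\<close> vanishes at \<open>xb\<close> by the
      choice of \<open>lb\<close>. On \<open>M\<close>, where \<open>\<Phi>\<close> vanishes,
      prox-regularity says exactly that \<open>xb\<close> is a local minimiser.\<close>
    define L where "L = (\<lambda>u. h u + \<Phi> u \<bullet> lb - u \<bullet> vb + r / 2 * ((u - xb) \<bullet> (u - xb)))"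
    define G where "G = (\<lambda>u. adjoint (h' u) 1 + adjoint (\<Phi>' u) lb - vb + r *\<^sub>R (u - xb))"
    define B where "B = (\<lambda>k. adjoint (h'' k) 1 + adjoint (\<Phi>'' k) lb + r *\<^sub>R k)"
    have "0 \<le> B d \<bullet> d"
    proof (rule second_order_along_curve[OF U(1,2) _ _ _ c(2,1)])
      fix u assume u: "u \<in> U"
      have du: "((\<lambda>v. v - xb) has_derivative (\<lambda>k. k)) (at u)"
        using has_derivative_diff[OF has_derivative_ident has_derivative_const[of xb]] by simp
      have "(L has_derivative (\<lambda>k. h' u k + \<Phi>' u k \<bullet> lb - k \<bullet> vb
          + r / 2 * ((u - xb) \<bullet> k + k \<bullet> (u - xb)))) (at u)"
        unfolding L_def
        by (intro has_derivative_add[OF has_derivative_diff[OF has_derivative_add]] h'U[OF u]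
            has_derivative_inner_left deriv_\<Phi>[OF u] has_derivative_ident has_derivative_mult_right
            has_derivative_inner[OF du du])
      moreover have "(\<lambda>k. h' u k + \<Phi>' u k \<bullet> lb - k \<bullet> vb + r / 2 * ((u - xb) \<bullet> k + k \<bullet> (u - xb)))
          = (\<lambda>k. G u \<bullet> k)"
        unfolding G_def
      proof
        fix k
        show "h' u k + \<Phi>' u k \<bullet> lb - k \<bullet> vb + r / 2 * ((u - xb) \<bullet> k + k \<bullet> (u - xb)) =
          (adjoint (h' u) 1 + adjoint (\<Phi>' u) lb - vb + r *\<^sub>R (u - xb)) \<bullet> k"
          by (simp add: inner_add_left inner_diff_left adjoint_inner inner_commute[of k] algebra_simps)
      qed
      ultimately show "(L has_derivative (\<lambda>k. G u \<bullet> k)) (at u)" by simp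
    next
      show "G xb = 0" unfolding G_def using lb(2) by (simp add: algebra_simps)
    next
      have "((\<lambda>u. adjoint (h' u) 1) has_derivative (\<lambda>k. adjoint (h'' k) 1)) (at xb)"
        using has_derivative_adjoint[OF h'' has_derivative_const[of "1::real"]]
        by (simp add: linear_0[OF adjoint_linear[OF linear_blinfun_apply]])
      moreover have "((\<lambda>u. adjoint (\<Phi>' u) lb) has_derivative (\<lambda>k. adjoint (\<Phi>'' k) lb)) (at xb)"
        using has_derivative_adjoint[OF \<Phi>'' has_derivative_const[of lb]]
        by (simp add: linear_0[OF adjoint_linear[OF linear_blinfun_apply]])
      moreover have "((\<lambda>u. r *\<^sub>R (u - xb)) has_derivative (\<lambda>k. r *\<^sub>R (k - 0))) (at xb)"
        by (intro has_derivative_scaleR_right has_derivative_diff has_derivative_ident has_derivative_const)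
      ultimately have "(G has_derivative (\<lambda>k. adjoint (h'' k) 1 + adjoint (\<Phi>'' k) lb - 0 + r *\<^sub>R (k - 0))) (at xb)"
        unfolding G_def by (intro has_derivative_add has_derivative_diff has_derivative_const)
      then show "(G has_derivative B) (at xb)" unfolding B_def by simp
    next
      have "(c \<longlongrightarrow> xb) (at 0)"
        using has_vector_derivative_continuous[OF c(2)] c(1) by (simp add: continuous_at isCont_def)
      then have "\<forall>\<^sub>F t in at 0. norm (c t - xb) < \<epsilon>"
        using tendstoD[OF _ \<epsilon>(1)] by (fastforce simp: dist_norm)
      then show "\<forall>\<^sub>F t in at 0. L xb \<le> L (c t)"
        using c(3)
      proof eventually_elim
        case (elim t)
        have "g (c t) \<ge> g xb + ereal (vb \<bullet> (c t - xb) - r / 2 * (norm (c t - xb))\<^sup>2)"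
          using \<epsilon>(2)[OF vb, of "c t"] elim(1) \<epsilon>(1) by (simp add: gh[OF xbM U(2)])
        moreover have "\<Phi> (c t) = 0" "\<Phi> xb = 0" using elim(2) in_M_iff xbM U(2) by auto
        moreover have "g (c t) = ereal (h (c t))" using elim(2) gh by blast
        ultimately show ?case
          unfolding L_def by (simp add: gh[OF xbM U(2)] power2_norm_eq_inner inner_diff_right inner_commute)
      qed
    qed
    moreover have "(\<rho> *\<^sub>R d + adjoint (h'' d) 1 + adjoint (\<Phi>'' d) lb) \<bullet> d = B d \<bullet> d + (\<rho> - r) * (d \<bullet> d)"
      unfolding B_def by (simp add: inner_add_left algebra_simps)
    moreover have "(\<rho> - r) * (d \<bullet> d) > 0" using \<rho>(2) d(2) by simp
    ultimately show ?thesis by linarith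
  qed

  have stat: "\<rho> *\<^sub>R (wb - xb) = adjoint (h' xb) 1 + adjoint (\<Phi>' xb) lb"
    using lb(2) unfolding vb_def by (simp add: algebra_simps)
  obtain V p where V: "open V" "wb \<in> V" "C1_on V p" "p wb = xb"
    and pU: "\<And>w. w \<in> V \<Longrightarrow> p w \<in> U" and pM: "\<And>w. w \<in> V \<Longrightarrow> p w \<in> M"
    and pN: "\<And>w d. w \<in> V \<Longrightarrow> \<Phi>' (p w) d = 0 \<Longrightarrow> (\<rho> *\<^sub>R (w - p w)) \<bullet> d = h' (p w) d"
    using stationary_branch[OF U(2) xbM C1h' h'' \<Phi>'' lb(1) \<rho>(1) stat pos] by blast
  have p_lim: "(p \<longlongrightarrow> xb) (nhds wb)"
    using C1_on_imp_continuous_on[OF V(3)] V(1,2,4)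
    by (metis continuous_on_eq_continuous_at isCont_def tendsto_at_iff_tendsto_nhds)
  have ev_V: "\<forall>\<^sub>F w in nhds wb. w \<in> V"
    using V(1,2) by (rule eventually_nhds_in_open)

  have ev_sub: "\<forall>\<^sub>F w in nhds wb. w \<in> V \<longrightarrow> \<rho> *\<^sub>R (w - p w) \<in> S (p w)"
  proof (rule ccontr)
    assume "\<not> ?thesis"
    then have "\<exists>w. dist w wb < 1 / real (Suc n) \<and> w \<in> V \<and> \<rho> *\<^sub>R (w - p w) \<notin> S (p w)" for n
      unfolding eventually_nhds_metric by (metis of_nat_0_less_iff zero_less_Suc zero_less_divide_1_iff)
    then obtain w where w: "\<And>n. dist (w n) wb < 1 / real (Suc n)" "\<And>n. w n \<in> V"
      "\<And>n. \<rho> *\<^sub>R (w n - p (w n)) \<notin> S (p (w n))" by metis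
    have w_lim: "w \<longlonglongrightarrow> wb"
      unfolding tendsto_dist_iff[of w]
      by (rule tendsto_sandwich[OF _ _ tendsto_const lim_1_over_n[THEN LIMSEQ_Suc]])
        (auto intro!: always_eventually less_imp_le w(1) simp del: of_nat_Suc)
    have pw_lim: "(\<lambda>n. p (w n)) \<longlonglongrightarrow> xb" using filterlim_compose[OF p_lim w_lim] .
    have v_lim: "(\<lambda>n. \<rho> *\<^sub>R (w n - p (w n))) \<longlonglongrightarrow> vb"
      unfolding vb_def by (intro tendsto_intros w_lim pw_lim)
    have "\<exists>n. \<rho> *\<^sub>R (w n - p (w n)) \<in> S (p (w n))"
    proof (rule normal_section_meets_sets[where X = "\<lambda>n. p (w n)" and S = S,
          OF U(2) _ pw_lim _ _ _ _ v_lim vb_ri aff])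
      fix n
      show "p (w n) \<in> U" by (rule pU[OF w(2)])
      note pw = pM[OF w(2)[of n]] pU[OF w(2)[of n]]
      show "closed (S (p (w n)))" "convex (S (p (w n)))" "S (p (w n)) \<noteq> {}"
        using Sreg(2)[OF pw] by (simp_all add: Sreg(1)[OF pw] closed_regular_subdiff convex_regular_subdiff)
      show "s \<bullet> d = (\<rho> *\<^sub>R (w n - p (w n))) \<bullet> d" if "s \<in> S (p (w n))" "\<Phi>' (p (w n)) d = 0" for s d
        using normal[OF pw that] pN[OF w(2) that(2)] by simp
    next
      show "\<exists>V. V \<longlonglongrightarrow> s \<and> (\<forall>\<^sub>F n in sequentially. V n \<in> S (p (w n)))" if "s \<in> S xb" for s
        using inner[OF that pM[OF w(2)] pw_lim] .
    qed
    then show False using w(3) by blast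
  qed

  \<comment> \<open>Both \<open>norm (w - wb)\<close> and \<open>norm (z - xb)\<close> will be below
    \<open>e\<close>; the second entry then keeps \<open>\<rho> *\<^sub>R (w - z)\<close> within
    \<open>\<epsilon>\<close> of \<open>vb\<close>.\<close>
  define e where "e = min (\<epsilon> / 2) (\<epsilon> * \<gamma> / 2)"
  have e: "e > 0" "e \<le> \<epsilon> / 2" "\<rho> * e \<le> \<epsilon> / 2"
    unfolding e_def \<rho>_def using \<epsilon>(1) \<gamma>(1) by (auto simp: min_def field_simps)
  have g_fin: "g xb = ereal (h xb)" by (rule gh[OF xbM U(2)])
  obtain \<delta> where \<delta>: "\<delta> > 0" "\<And>w z. norm (w - wb) < \<delta> \<Longrightarrow> z \<in> prox g \<gamma> w \<Longrightarrow>
      norm (z - xb) < e \<and> g z < g xb + ereal e"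
    using prox_stable[OF g \<gamma>(1) single prox_ne e(1)] \<gamma>(1) by (metis mult_pos_pos zero_less_numeral)
  have ev1: "\<forall>\<^sub>F w in nhds wb. norm (w - wb) < min \<delta> e"
    unfolding eventually_nhds_metric using \<delta>(1) e(1) by (intro exI[of _ "min \<delta> e"]) (simp add: dist_norm)
  have ev2: "\<forall>\<^sub>F w in nhds wb. norm (p w - xb) < e"
    using tendstoD[OF p_lim e(1)] by (simp add: dist_norm)
  have "isCont h xb" using h'U[OF U(2)] by (rule has_derivative_continuous)
  then have "((\<lambda>w. h (p w)) \<longlongrightarrow> h xb) (nhds wb)"
    using p_lim by (rule isCont_tendsto_compose)
  then have ev3: "\<forall>\<^sub>F w in nhds wb. h (p w) < h xb + \<epsilon>"
    using \<epsilon>(1) by (intro order_tendstoD) auto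
  have "\<forall>\<^sub>F w in nhds wb. w \<in> V \<and> prox g \<gamma> w = {p w}"
    using ev_V ev_sub ev1 ev2 ev3
  proof eventually_elim
    case (elim w)
    have close: "norm (\<rho> *\<^sub>R (w - z) - vb) < \<epsilon>" if "norm (z - xb) < e" for z
    proof -
      have "\<rho> *\<^sub>R (w - z) - vb = \<rho> *\<^sub>R ((w - wb) - (z - xb))"
        unfolding vb_def by (simp add: algebra_simps)
      then have "norm (\<rho> *\<^sub>R (w - z) - vb) \<le> \<rho> * (norm (w - wb) + norm (z - xb))"
        using \<rho>(1) norm_triangle_ineq4[of "w - wb" "z - xb"] by simp
      also have "\<dots> < \<rho> * (e + e)"
        using elim(3) that \<rho>(1) by (intro mult_strict_left_mono) auto
      finally show ?thesis using e(3) by (simp add: distrib_left)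
    qed
    have gp: "g (p w) = ereal (h (p w))" using gh[OF pM pU] elim(1) by blast
    \<comment> \<open>Adding the prox-regularity inequalities at \<open>z\<close> and at
      \<open>p w\<close>, each tested at the other point, bounds the failure of monotonicity by
      \<open>r\<close>, while the two subgradients contribute \<open>- \<rho>\<close>; as
      \<open>r < \<rho>\<close>, the points coincide.\<close>
    have "z = p w" if z: "z \<in> prox g \<gamma> w" for z
    proof -
      have zb: "norm (z - xb) < e" "g z < g xb + ereal e" using \<delta>(2)[OF _ z] elim(3) by auto
      obtain b where b: "g z = ereal b" using prox_finite[OF g(1) z] by auto
      have "\<rho> *\<^sub>R (w - z) \<in> S z"
        using prox_subgradient[OF g(1) \<gamma>(1) z] regular_subdiff_subset_limiting
        unfolding \<rho>_def S_def by blast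
      then have "g (p w) \<ge> g z + ereal ((\<rho> *\<^sub>R (w - z)) \<bullet> (p w - z) - r / 2 * (norm (p w - z))\<^sup>2)"
        by (rule \<epsilon>(2)) (use zb elim(4) e \<epsilon>(1) close[OF zb(1)] in \<open>auto simp: b g_fin\<close>)
      moreover have "\<rho> *\<^sub>R (w - p w) \<in> S (p w)" using elim(1,2) by blast
      then have "g z \<ge> g (p w) + ereal ((\<rho> *\<^sub>R (w - p w)) \<bullet> (z - p w) - r / 2 * (norm (z - p w))\<^sup>2)"
        by (rule \<epsilon>(2)) (use zb elim(4,5) e \<epsilon>(1) close[OF elim(4)] in \<open>auto simp: gp g_fin\<close>)
      ultimately have "(\<rho> *\<^sub>R (w - z)) \<bullet> (p w - z) + (\<rho> *\<^sub>R (w - p w)) \<bullet> (z - p w)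
          - r * (norm (p w - z))\<^sup>2 \<le> 0"
        by (simp add: b gp norm_minus_commute[of z])
      moreover have "(\<rho> *\<^sub>R (w - z)) \<bullet> (p w - z) + (\<rho> *\<^sub>R (w - p w)) \<bullet> (z - p w)
          = \<rho> * (norm (p w - z))\<^sup>2"
        by (simp add: power2_norm_eq_inner inner_diff_left inner_diff_right inner_commute algebra_simps)
      ultimately have "(\<rho> - r) * (norm (p w - z))\<^sup>2 \<le> 0" by (simp add: algebra_simps)
      then show ?thesis using \<rho>(2) by (simp add: mult_le_0_iff)
    qed
    then show ?case using prox_ne[OF \<gamma>(1), of w] elim(1) by blast
  qed
  then obtain O' where O': "open O'" "wb \<in> O'" "\<And>w. w \<in> O' \<Longrightarrow> w \<in> V \<and> prox g \<gamma> w = {p w}"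
    unfolding eventually_nhds by blast
  show ?thesis
    unfolding C1_and_valued_near_def
  proof (intro exI conjI ballI)
    show "C1_on O' p" using O'(3) by (intro C1_on_subset[OF V(3)]) blast
  qed (use O' pM in auto)
qed

section \<open>Composition with the gradient step\<close>

lemma C1_on_grad:
  fixes f :: "'a::euclidean_space \<Rightarrow> real"
  assumes "C2_on UNIV f"
  shows "C1_on UNIV (grad f)"
proof -
  obtain f' where f': "\<And>x. (f has_derivative blinfun_apply (f' x)) (at x)" "C1_on UNIV f'"
    using assms unfolding C2_on_def by blast
  \<comment> \<open>The Riesz vector of a functional is its adjoint applied to 1.\<close>
  have eq: "grad f x = adjoint (f' x) 1" for x
    unfolding grad_def
  proof (rule the_equality)
    have "(\<lambda>k. k \<bullet> adjoint (f' x) 1) = f' x"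
      by (rule ext) (simp add: adjoint_works[OF linear_blinfun_apply])
    then show "GDERIV f x :> adjoint (f' x) 1" unfolding gderiv_def using f'(1) by simp
  next
    fix D assume "GDERIV f x :> D"
    then have "(\<lambda>k. k \<bullet> D) = f' x"
      unfolding gderiv_def using f'(1) by (rule has_derivative_unique)
    then have "f' x k = k \<bullet> D" for k by (metis (no_types))
    then have "\<forall>k. k \<bullet> D = k \<bullet> adjoint (f' x) 1" by (simp add: adjoint_works[OF linear_blinfun_apply])
    then show "D = adjoint (f' x) 1" by (simp only: vector_eq_ldot)
  qed
  have "C1_on UNIV (\<lambda>x. adjoint (f' x) 1)" by (intro C1_on_adjoint f'(2) C1_on_const)
  then show ?thesis unfolding eq[abs_def, symmetric] .
qed

lemma prox_grad_C1:
  assumes f: "C2_on UNIV f" and p: "C1_and_valued_near (prox g \<gamma>) M (y - \<gamma> *\<^sub>R grad f y)"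
  shows "C1_and_valued_near (prox_grad f g \<gamma>) M y"
proof -
  define s where "s = (\<lambda>y. y - \<gamma> *\<^sub>R grad f y)"
  have "C1_on UNIV (\<lambda>y. y + (- \<gamma>) *\<^sub>R grad f y)"
    by (intro C1_on_add C1_on_linear_compose[OF bounded_linear_scaleR_right] C1_on_grad f
        C1_on_bounded_linear bounded_linear_ident)
  then have s: "C1_on UNIV s" unfolding s_def by simp
  obtain U q where U: "open U" "s y \<in> U" "\<And>w. w \<in> U \<Longrightarrow> prox g \<gamma> w = {q w} \<and> q w \<in> M" "C1_on U q"
    using p unfolding C1_and_valued_near_def s_def by blast
  show ?thesis
    unfolding C1_and_valued_near_def prox_grad_def s_def[symmetric]
  proof (intro exI conjI)
    show "open (s -` U)"
      by (rule open_vimage[OF U(1) C1_on_imp_continuous_on[OF s]])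
    show "C1_on (s -` U) (\<lambda>y. q (s y))"
      by (rule C1_on_compose[OF C1_on_subset[OF s] U(4)]) auto
    show "\<forall>x\<in>s -` U. prox g \<gamma> (x - \<gamma> *\<^sub>R grad f x) = {q (s x)} \<and> q (s x) \<in> M"
      using U(3) unfolding s_def by simp
  qed (use U(2) in simp)
qed

theorem theorem3p1:
  fixes f :: "'a::euclidean_space \<Rightarrow> real" and g :: "'a \<Rightarrow> ereal"
    and M :: "'a set" and xb :: 'a and r :: real
  assumes f_C2: "C2_on UNIV f"
    and g_proper: "proper_fun g"
    and g_lsc: "lsc g"
    and prox_nonempty: "\<And>y \<gamma>. \<gamma> > 0 \<Longrightarrow> prox g \<gamma> y \<noteq> {}"
    and r_pos: "r > 0"
    and prox_reg: "prox_regular_at r g xb"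
    and part_smooth: "partly_smooth_at g M xb"
  shows
    "(\<forall>yb \<gamma>b. 0 < \<gamma>b \<and> \<gamma>b \<le> 1 / r \<and> prox_grad f g \<gamma>b yb = {xb} \<longrightarrow>
        (\<exists>\<gamma>0<\<gamma>b. \<forall>\<gamma>. \<gamma>0 < \<gamma> \<and> \<gamma> < \<gamma>b \<and> 0 < \<gamma> \<and>
           (1 / \<gamma>) *\<^sub>R (yb - xb) - grad f yb \<in> rel_interior (limiting_subdiff g xb) \<longrightarrow>
           C1_and_valued_near (prox_grad f g \<gamma>) M yb))
     \<and>
     (\<forall>\<gamma> \<gamma>b. 0 < \<gamma> \<and> \<gamma> < \<gamma>b \<and> \<gamma>b \<le> 1 / r \<longrightarrow>
        (\<exists>\<delta>>0. \<forall>yb. norm (yb - xb) < \<delta> \<and>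
           (1 / \<gamma>) *\<^sub>R (yb - xb) - grad f yb \<in> rel_interior (limiting_subdiff g xb) \<and>
           prox_grad f g \<gamma>b yb = {xb} \<longrightarrow>
           C1_and_valued_near (prox_grad f g \<gamma>) M yb))"
proof (intro conjI allI impI)
  define S where "S = limiting_subdiff g xb"
  define V where "V = (\<lambda>\<gamma> y. (1 / \<gamma>) *\<^sub>R (y - xb) - grad f y)"
  have V: "(1 / \<gamma>) *\<^sub>R ((y - \<gamma> *\<^sub>R grad f y) - xb) = V \<gamma> y" if "\<gamma> > 0" for \<gamma> y
    using that unfolding V_def by (simp add: scaleR_diff_right)
  have pr: "\<exists>\<epsilon>>0. \<forall>v u. v \<in> S \<and> norm (v - vb) < \<epsilon> \<and> norm (u - xb) < \<epsilon> \<longrightarrow>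
      g u \<ge> g xb + ereal (v \<bullet> (u - xb) - r / 2 * (norm (u - xb))\<^sup>2)" if "vb \<in> S" for vb
  proof -
    have pr: "prox_regular_at_for r g xb vb"
      using prox_reg that unfolding prox_regular_at_def S_def by blast
    then obtain \<epsilon> where \<epsilon>: "\<epsilon> > 0" "\<forall>x x' v. v \<in> limiting_subdiff g x \<and> norm (x - xb) < \<epsilon> \<and>
        norm (x' - xb) < \<epsilon> \<and> norm (v - vb) < \<epsilon> \<and> g x < g xb + ereal \<epsilon> \<longrightarrow>
        g x' \<ge> g x + ereal (v \<bullet> (x' - x) - r / 2 * (norm (x' - x))\<^sup>2)"
      unfolding prox_regular_at_for_def by blast
    have "\<bar>g xb\<bar> \<noteq> \<infinity>" using pr unfolding prox_regular_at_for_def by simp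
    then have "g xb < g xb + ereal \<epsilon>" using \<epsilon>(1) by (cases "g xb") auto
    then show ?thesis using \<epsilon> unfolding S_def by (intro exI[of _ \<epsilon>]) auto
  qed
  \<comment> \<open>Both cases end here. They differ in how the radius \<open>\<epsilon>\<close> is
    found and in how the range between \<open>\<epsilon>\<close> and
    \<open>2 * norm (y - xb)\<close> is handled.\<close>
  have core: "C1_and_valued_near (prox_grad f g \<gamma>) M y"
    if \<gamma>: "0 < \<gamma>" "\<gamma> < \<gamma>b" "\<gamma>b \<le> 1 / r" and sg: "prox_grad f g \<gamma>b y = {xb}"
      and ri: "V \<gamma> y \<in> rel_interior S" and \<epsilon>: "\<epsilon> > 0"
      and local: "\<And>u. norm (u - xb) < \<epsilon> \<Longrightarrow>
        g u \<ge> g xb + ereal (V \<gamma> y \<bullet> (u - xb) - r / 2 * (norm (u - xb))\<^sup>2)"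
      and middle: "\<And>u. \<epsilon> \<le> norm (u - xb) \<Longrightarrow> norm (u - xb) \<le> 2 * norm (y - xb) \<Longrightarrow>
        g u > g xb + ereal (V \<gamma> y \<bullet> (u - xb) - 1 / (2 * \<gamma>) * (norm (u - xb))\<^sup>2)"
    for \<gamma> \<gamma>b y \<epsilon>
  proof (rule prox_grad_C1[OF f_C2])
    have "1 / \<gamma>b < 1 / \<gamma>" using \<gamma> by (simp add: frac_less2)
    moreover have "r \<le> 1 / \<gamma>b" using \<gamma> r_pos by (simp add: field_simps)
    ultimately have r: "r < 1 / \<gamma>" by simp
    have \<gamma>b: "\<gamma>b > 0" using \<gamma> by simp
    have "prox g \<gamma> (y - \<gamma> *\<^sub>R grad f y) = {xb}"
    proof (rule prox_decrease_step[OF g_proper \<gamma>(1,2) sg[unfolded prox_grad_def] r \<epsilon>,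
          where w = "y - \<gamma> *\<^sub>R grad f y" and p = "y - xb", unfolded V[OF \<gamma>(1)] V[OF \<gamma>b]])
      \<comment> \<open>The gradient is taken at the same \<open>y\<close> for both steps and
        cancels, which leaves \<open>y - xb\<close> as the displacement \<open>p\<close>.\<close>
      show "V \<gamma> y = V \<gamma>b y + (1 / \<gamma> - 1 / \<gamma>b) *\<^sub>R (y - xb)"
        unfolding V_def by (simp add: scaleR_diff_left)
    qed (use local middle in auto)
    then show "C1_and_valued_near (prox g \<gamma>) M (y - \<gamma> *\<^sub>R grad f y)"
      using ri unfolding S_def
      by (intro partly_smooth_prox_C1[OF g_proper g_lsc prox_nonempty prox_reg part_smooth \<gamma>(1) r])
        (simp_all only: V[OF \<gamma>(1)])
  qed
  {
    fix yb \<gamma>b assume "0 < \<gamma>b \<and> \<gamma>b \<le> 1 / r \<and> prox_grad f g \<gamma>b yb = {xb}"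
    then have \<gamma>b: "0 < \<gamma>b" "\<gamma>b \<le> 1 / r" and sg: "prox_grad f g \<gamma>b yb = {xb}" by auto
    define wb where "wb = yb - \<gamma>b *\<^sub>R grad f yb"
    define p where "p = norm (yb - xb)"
    have p0: "p \<ge> 0" unfolding p_def by simp
    have sg': "prox g \<gamma>b wb = {xb}" using sg unfolding prox_grad_def wb_def .
    obtain a where a: "g xb = ereal a" using prox_finite[OF g_proper, of xb \<gamma>b wb] sg' by auto
    have "V \<gamma>b yb \<in> S"
      using prox_subgradient[OF g_proper \<gamma>b(1), of xb wb] sg' regular_subdiff_subset_limiting[of g xb]
      unfolding S_def wb_def V[OF \<gamma>b(1)] by auto
    then obtain \<epsilon> where \<epsilon>: "\<epsilon> > 0" "\<And>v u. v \<in> S \<Longrightarrow> norm (v - V \<gamma>b yb) < \<epsilon> \<Longrightarrow> norm (u - xb) < \<epsilon> \<Longrightarrow>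
        g u \<ge> g xb + ereal (v \<bullet> (u - xb) - r / 2 * (norm (u - xb))\<^sup>2)"
      using pr by blast
    define q where "q = (\<lambda>u. a + (V \<gamma>b yb \<bullet> (u - xb) - 1 / (2 * \<gamma>b) * (norm (u - xb))\<^sup>2))"
    define N where "N = cball xb (2 * p) - ball xb \<epsilon>"
    have "compact N" unfolding N_def by (intro compact_diff) auto
    moreover have "continuous_on N q" unfolding q_def by (intro continuous_intros)
    moreover have "g u > ereal (q u)" if "u \<in> N" for u
    proof -
      have "u \<noteq> xb" using that \<epsilon>(1) unfolding N_def by auto
      then show ?thesis
        using sg' unfolding prox_eq_singleton_iff[OF g_proper \<gamma>b(1)] q_def a
        by (simp add: wb_def V[OF \<gamma>b(1)])
    qed
    ultimately obtain c where c: "c > 0" "\<And>u. u \<in> N \<Longrightarrow> g u \<ge> ereal (q u + c)"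
      using lsc_compact_gap[OF g_lsc] by blast
    \<comment> \<open>A bound for \<open>1/\<gamma> - 1/\<gamma>b\<close>: the first entry keeps the
      perturbation of the minorant below the gap \<open>c\<close>, the second keeps the new
      subgradient within \<open>\<epsilon>\<close> of the old one. Adding 1 covers
      \<open>p = 0\<close>. By its choice below, \<open>\<gamma>0\<close> satisfies
      \<open>1/\<gamma>0 - 1/\<gamma>b = k0\<close>.\<close>
    define k0 where "k0 = min (c / (p\<^sup>2 + 1)) (\<epsilon> / (p + 1))"
    have k0: "k0 > 0" unfolding k0_def using c(1) \<epsilon>(1) p0 by (simp add: add_nonneg_pos)
    define \<gamma>0 where "\<gamma>0 = 1 / (k0 + 1 / \<gamma>b)"
    have \<gamma>0: "0 < \<gamma>0" "\<gamma>0 < \<gamma>b"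
      unfolding \<gamma>0_def using k0 \<gamma>b(1) by (auto simp: field_simps add_pos_pos)
    show "\<exists>\<gamma>0<\<gamma>b. \<forall>\<gamma>. \<gamma>0 < \<gamma> \<and> \<gamma> < \<gamma>b \<and> 0 < \<gamma> \<and>
           (1 / \<gamma>) *\<^sub>R (yb - xb) - grad f yb \<in> rel_interior (limiting_subdiff g xb) \<longrightarrow>
           C1_and_valued_near (prox_grad f g \<gamma>) M yb"
    proof (intro exI[of _ \<gamma>0] conjI allI impI \<gamma>0(2))
      fix \<gamma> assume "\<gamma>0 < \<gamma> \<and> \<gamma> < \<gamma>b \<and> 0 < \<gamma> \<and>
           (1 / \<gamma>) *\<^sub>R (yb - xb) - grad f yb \<in> rel_interior (limiting_subdiff g xb)"
      then have \<gamma>: "\<gamma>0 < \<gamma>" "\<gamma> < \<gamma>b" "0 < \<gamma>" and ri: "V \<gamma> yb \<in> rel_interior S"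
        unfolding S_def V_def by auto
      define k where "k = 1 / \<gamma> - 1 / \<gamma>b"
      have k: "0 < k" unfolding k_def using \<gamma> by (simp add: frac_less2)
      have "1 / \<gamma> < 1 / \<gamma>0" using \<gamma> \<gamma>0 by (simp add: frac_less2)
      then have k_k0: "k < k0" unfolding k_def \<gamma>0_def by simp
      have kc: "k * p\<^sup>2 < c"
      proof -
        have "k * p\<^sup>2 \<le> k0 * p\<^sup>2" using k_k0 by (intro mult_right_mono) auto
        also have "\<dots> \<le> c / (p\<^sup>2 + 1) * p\<^sup>2" unfolding k0_def by (intro mult_right_mono) auto
        also have "\<dots> = c * (p\<^sup>2 / (p\<^sup>2 + 1))" by simp
        also have "\<dots> < c * 1"
          using c(1) by (intro mult_strict_left_mono) (auto simp: add_nonneg_pos)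
        finally show ?thesis by simp
      qed
      have ke: "k * p < \<epsilon>"
      proof -
        have "k * p \<le> k0 * p" using k_k0 p0 by (intro mult_right_mono) auto
        also have "\<dots> \<le> \<epsilon> / (p + 1) * p" unfolding k0_def using p0 by (intro mult_right_mono) auto
        also have "\<dots> = \<epsilon> * (p / (p + 1))" by simp
        also have "\<dots> < \<epsilon> * 1"
          using \<epsilon>(1) p0 by (intro mult_strict_left_mono) auto
        finally show ?thesis by simp
      qed
      have V_eq: "V \<gamma> yb = V \<gamma>b yb + k *\<^sub>R (yb - xb)"
        unfolding V_def k_def by (simp add: scaleR_diff_left)
      then have "norm (V \<gamma> yb - V \<gamma>b yb) < \<epsilon>" using ke k by (simp add: p_def)
      note local = \<epsilon>(2)[OF subsetD[OF rel_interior_subset ri] this]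
      show "C1_and_valued_near (prox_grad f g \<gamma>) M yb"
      proof (rule core[OF \<gamma>(3,2) \<gamma>b(2) sg ri \<epsilon>(1) local])
        fix u assume u: "\<epsilon> \<le> norm (u - xb)" "norm (u - xb) \<le> 2 * norm (yb - xb)"
        define d where "d = u - xb"
        \<comment> \<open>Completing the square bounds the added term uniformly in
          \<open>d\<close>.\<close>
        have "0 \<le> (norm (yb - xb - d))\<^sup>2" by simp
        then have "(yb - xb) \<bullet> d - (norm d)\<^sup>2 / 2 \<le> p\<^sup>2 / 2"
          unfolding p_def power2_norm_eq_inner by (simp add: inner_diff_left inner_diff_right inner_commute)
        then have "k * ((yb - xb) \<bullet> d - (norm d)\<^sup>2 / 2) \<le> k * (p\<^sup>2 / 2)"
          using k by (intro mult_left_mono) auto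
        also have "\<dots> \<le> k * p\<^sup>2" using k by (intro mult_left_mono) auto
        also note kc
        finally have 1: "k * ((yb - xb) \<bullet> d - (norm d)\<^sup>2 / 2) < c" .
        have "1 / (2 * \<gamma>) = 1 / (2 * \<gamma>b) + k / 2" unfolding k_def by (simp add: diff_divide_distrib)
        then have "V \<gamma> yb \<bullet> d - 1 / (2 * \<gamma>) * (norm d)\<^sup>2
            = V \<gamma>b yb \<bullet> d - 1 / (2 * \<gamma>b) * (norm d)\<^sup>2 + k * ((yb - xb) \<bullet> d - (norm d)\<^sup>2 / 2)"
          unfolding V_eq by (simp add: inner_add_left algebra_simps)
        then have "a + (V \<gamma> yb \<bullet> d - 1 / (2 * \<gamma>) * (norm d)\<^sup>2) < q u + c"
          using 1 unfolding q_def d_def by simp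
        moreover have "u \<in> N" using u unfolding N_def p_def by (auto simp: dist_norm norm_minus_commute)
        ultimately show "g u > g xb + ereal (V \<gamma> yb \<bullet> (u - xb) - 1 / (2 * \<gamma>) * (norm (u - xb))\<^sup>2)"
          using c(2)[of u] unfolding a d_def by (cases "g u") auto
      qed
    qed
  next
    fix \<gamma> \<gamma>b assume "0 < \<gamma> \<and> \<gamma> < \<gamma>b \<and> \<gamma>b \<le> 1 / r"
    then have \<gamma>: "0 < \<gamma>" "\<gamma> < \<gamma>b" "\<gamma>b \<le> 1 / r" by auto
    have V_cont: "continuous_on UNIV (V \<gamma>)"
      unfolding V_def by (intro continuous_intros C1_on_imp_continuous_on C1_on_grad f_C2)
    have V_near: "\<exists>\<delta>>0. \<forall>y. norm (y - xb) < \<delta> \<longrightarrow> norm (V \<gamma> y - V \<gamma> xb) < e" if "e > 0" for e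
      using V_cont that unfolding continuous_on_iff by (auto simp: dist_norm)
    have S_closed: "closed S"
    proof -
      obtain e where e: "e > 0" "\<forall>x \<in> M \<inter> ball xb e. clarke_regular_at g x \<and> limiting_subdiff g x \<noteq> {}"
        using part_smooth unfolding partly_smooth_at_def by meson
      moreover have "xb \<in> M"
        using part_smooth unfolding partly_smooth_at_def C2_submanifold_around_def by simp
      ultimately have "clarke_regular_at g xb" by simp
      then show ?thesis
        unfolding clarke_regular_at_def S_def using closed_regular_subdiff[of g xb] by simp
    qed
    show "\<exists>\<delta>>0. \<forall>yb. norm (yb - xb) < \<delta> \<and>
           (1 / \<gamma>) *\<^sub>R (yb - xb) - grad f yb \<in> rel_interior (limiting_subdiff g xb) \<and>
           prox_grad f g \<gamma>b yb = {xb} \<longrightarrow>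
           C1_and_valued_near (prox_grad f g \<gamma>) M yb"
    proof (cases "V \<gamma> xb \<in> S")
      case True
      then obtain \<epsilon> where \<epsilon>: "\<epsilon> > 0" "\<And>v u. v \<in> S \<Longrightarrow> norm (v - V \<gamma> xb) < \<epsilon> \<Longrightarrow> norm (u - xb) < \<epsilon> \<Longrightarrow>
          g u \<ge> g xb + ereal (v \<bullet> (u - xb) - r / 2 * (norm (u - xb))\<^sup>2)"
        using pr by blast
      obtain \<delta> where \<delta>: "\<delta> > 0" "\<And>y. norm (y - xb) < \<delta> \<Longrightarrow> norm (V \<gamma> y - V \<gamma> xb) < \<epsilon>"
        using V_near[OF \<epsilon>(1)] by blast
      show ?thesis
      \<comment> \<open>With \<open>2 * norm (y - xb) < \<epsilon>\<close> no displacement is left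
        for the middle range.\<close>
      proof (intro exI[of _ "min \<delta> (\<epsilon> / 2)"] conjI allI impI)
        show "min \<delta> (\<epsilon> / 2) > 0" using \<delta>(1) \<epsilon>(1) by simp
        fix y assume "norm (y - xb) < min \<delta> (\<epsilon> / 2) \<and>
           (1 / \<gamma>) *\<^sub>R (y - xb) - grad f y \<in> rel_interior (limiting_subdiff g xb) \<and>
           prox_grad f g \<gamma>b y = {xb}"
        then have y: "norm (y - xb) < \<delta>" "2 * norm (y - xb) < \<epsilon>" "V \<gamma> y \<in> rel_interior S"
          "prox_grad f g \<gamma>b y = {xb}"
          unfolding V_def S_def by auto
        show "C1_and_valued_near (prox_grad f g \<gamma>) M y"
          by (rule core[OF \<gamma> y(4,3) \<epsilon>(1) \<epsilon>(2)[OF subsetD[OF rel_interior_subset y(3)] \<delta>(2)[OF y(1)]]])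
            (use y(2) in auto)
      qed
    next
      \<comment> \<open>Here the claim holds vacuously: by continuity \<open>V \<gamma> y\<close>
        stays outside the closed set \<open>S\<close> for \<open>y\<close> near
        \<open>xb\<close>.\<close>
      case False
      then obtain e where e: "e > 0" "ball (V \<gamma> xb) e \<subseteq> - S"
        using openE[OF open_Compl[OF S_closed], of "V \<gamma> xb"] by blast
      obtain \<delta> where \<delta>: "\<delta> > 0" "\<And>y. norm (y - xb) < \<delta> \<Longrightarrow> norm (V \<gamma> y - V \<gamma> xb) < e"
        using V_near[OF e(1)] by blast
      have "V \<gamma> y \<notin> rel_interior S" if "norm (y - xb) < \<delta>" for y
      proof -
        have "V \<gamma> y \<in> ball (V \<gamma> xb) e" using \<delta>(2)[OF that] by (simp add: dist_norm norm_minus_commute)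
        then show ?thesis using e(2) rel_interior_subset[of S] by blast
      qed
      then show ?thesis using \<delta>(1) unfolding V_def S_def by blast
    qed
  }
qed

end
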